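(* Let $d\in\mathbb{N}$, let $w(k)>0$, $k\in\mathbb{Z}^d$, be weights with $\sum_{k\in\mathbb{Z}^d}w(k)^{-2}<\infty$, and let $(\sigma_j)_{j\in\mathbb{N}}$ be the non-increasing rearrangement of $(1/w(k))_{k\in\mathbb{Z}^d}$. Let $G_d$ be any one of the spaces $\mathcal{A}(\mathbb{T}^d)$, $C(\mathbb{T}^d)$, $L_\infty(\mathbb{T}^d)$. Then for all $n\in\mathbb{N}$ $$a_n(I_d:F_d(w)\to G_d)=\Big(\sum_{j=n}^\infty\sigma_j^2\Big)^{1/2}.$$ (Equivalently, since $\sigma_j=a_j(I_d:F_d(w)\to L_2(\mathbb{T}^d))$, one has $a_n(I_d:F_d(w)\to G_d)=\big(\sum_{j\ge n}a_j(I_d:F_d(w)\to L_2(\mathbb{T}^d))^2\big)^{1/2}$.)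
   Context: $\mathbb{T}^d=[0,2\pi)^d$ is the $d$-dimensional torus with the normalized Lebesgue measure $(2\pi)^{-d}dx$; all $L_p(\mathbb{T}^d)$-norms refer to this measure. For $f\in L_1(\mathbb{T}^d)$, $\hat f(k)=(2\pi)^{-d}\int_{\mathbb{T}^d}f(x)e^{-ik\cdot x}dx$. For weights $w(k)>0$, $F_d(w)$ is the Hilbert space of all $f\in L_1(\mathbb{T}^d)$ with $\|f|F_d(w)\|=\big(\sum_{k}w(k)^2|\hat f(k)|^2\big)^{1/2}<\infty$. $\mathcal{A}(\mathbb{T}^d)$ (Wiener algebra) is the Banach space of $f\in L_1(\mathbb{T}^d)$ with $\|f|\mathcal{A}(\mathbb{T}^d)\|=\sum_k|\hat f(k)|<\infty$; $C(\mathbb{T}^d)$ is the space of continuous periodic functions with sup-norm; functions having a continuous representative are identified with it. $I_d$ denotes the inclusion map. For a bounded linear operator $T:X\to Y$ between Banach spaces, $a_n(T)=\inf\{\|T-A\|: A:X\to Y \text{ bounded linear},\ \operatorname{rank}A<n\}$. *)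

theory Defs
  imports "HOL-Analysis.Analysis"
begin

text \<open>The dimension d is CARD('n) for a finite index type 'n. Functions on the
torus are represented as 2pi-periodic functions on real^'n; the fundamental
domain is the cube [0,2pi)^d.\<close>

definition torus_periodic :: "(real^'n \<Rightarrow> complex) \<Rightarrow> bool" where
  "torus_periodic f \<longleftrightarrow> (\<forall>x i. f (x + (2*pi) *\<^sub>R axis i 1) = f x)"

definition torus_cube :: "(real^'n) set" where
  "torus_cube = {x. \<forall>i. 0 \<le> x$i \<and> x$i < 2*pi}"

definition kdot :: "int^'n \<Rightarrow> real^'n \<Rightarrow> real" where
  "kdot k x = (\<Sum>i\<in>UNIV. real_of_int (k$i) * x$i)"

definition torus_int :: "(real^'n \<Rightarrow> complex) \<Rightarrow> complex" where
  "torus_int f = complex_of_real (1 / (2*pi) ^ CARD('n)) * (LINT x:torus_cube|lebesgue. f x)"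

definition fourier_coeff :: "(real^'n \<Rightarrow> complex) \<Rightarrow> int^'n \<Rightarrow> complex" where
  "fourier_coeff f k = torus_int (\<lambda>x. f x * exp (- \<i> * complex_of_real (kdot k x)))"

definition L1_torus :: "(real^'n \<Rightarrow> complex) set" where
  "L1_torus = {f. torus_periodic f \<and> set_integrable lebesgue torus_cube f}"

definition F_space :: "(int^'n \<Rightarrow> real) \<Rightarrow> (real^'n \<Rightarrow> complex) set" where
  "F_space w = {f \<in> L1_torus. (\<lambda>k. (w k)\<^sup>2 * (cmod (fourier_coeff f k))\<^sup>2) summable_on UNIV}"

definition F_norm :: "(int^'n \<Rightarrow> real) \<Rightarrow> (real^'n \<Rightarrow> complex) \<Rightarrow> real" where
  "F_norm w f = sqrt (\<Sum>\<^sub>\<infinity>k. (w k)\<^sup>2 * (cmod (fourier_coeff f k))\<^sup>2)"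

definition Wiener_space :: "(real^'n \<Rightarrow> complex) set" where
  "Wiener_space = {f \<in> L1_torus. (\<lambda>k. cmod (fourier_coeff f k)) summable_on UNIV}"

definition Wiener_norm :: "(real^'n \<Rightarrow> complex) \<Rightarrow> real" where
  "Wiener_norm f = (\<Sum>\<^sub>\<infinity>k. cmod (fourier_coeff f k))"

definition Linf_space :: "(real^'n \<Rightarrow> complex) set" where
  "Linf_space = {f. torus_periodic f \<and> set_borel_measurable lebesgue torus_cube f \<and>
      (\<exists>C. AE x in lebesgue. x \<in> torus_cube \<longrightarrow> cmod (f x) \<le> C)}"

definition Linf_norm :: "(real^'n \<Rightarrow> complex) \<Rightarrow> real" where
  "Linf_norm f = Inf {C. 0 \<le> C \<and> (AE x in lebesgue. x \<in> torus_cube \<longrightarrow> cmod (f x) \<le> C)}"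

text \<open>C(T^d): (classes of) functions having a continuous periodic representative,
normed by the sup norm, which equals the essential sup of any representative.\<close>
definition C_space :: "(real^'n \<Rightarrow> complex) set" where
  "C_space = {f \<in> Linf_space. \<exists>h. continuous_on UNIV h \<and> torus_periodic h \<and>
      (AE x in lebesgue. x \<in> torus_cube \<longrightarrow> f x = h x)}"

definition lin_on :: "('a \<Rightarrow> complex) set \<Rightarrow> (('a \<Rightarrow> complex) \<Rightarrow> ('a \<Rightarrow> complex)) \<Rightarrow> bool" where
  "lin_on X A \<longleftrightarrow> (\<forall>f\<in>X. \<forall>g\<in>X. \<forall>a b::complex.
      A (\<lambda>x. a * f x + b * g x) = (\<lambda>x. a * A f x + b * A g x))"

definition bounded_op :: "('a \<Rightarrow> complex) set \<Rightarrow> (('a \<Rightarrow> complex) \<Rightarrow> real) \<Rightarrow>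
    (('a \<Rightarrow> complex) \<Rightarrow> real) \<Rightarrow> (('a \<Rightarrow> complex) \<Rightarrow> ('a \<Rightarrow> complex)) \<Rightarrow> bool" where
  "bounded_op X NX NY A \<longleftrightarrow> (\<exists>C. \<forall>f\<in>X. NY (A f) \<le> C * NX f)"

definition rank_less :: "('a \<Rightarrow> complex) set \<Rightarrow> (('a \<Rightarrow> complex) \<Rightarrow> ('a \<Rightarrow> complex)) \<Rightarrow> nat \<Rightarrow> bool" where
  "rank_less X A n \<longleftrightarrow> (\<exists>B. finite B \<and> card B < n \<and>
      (\<forall>f\<in>X. \<exists>c. A f = (\<lambda>x. \<Sum>g\<in>B. c g * g x)))"

definition approx_num :: "('a \<Rightarrow> complex) set \<Rightarrow> (('a \<Rightarrow> complex) \<Rightarrow> real) \<Rightarrow>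
    ('a \<Rightarrow> complex) set \<Rightarrow> (('a \<Rightarrow> complex) \<Rightarrow> real) \<Rightarrow> nat \<Rightarrow> real" where
  "approx_num X NX Y NY n = Inf {(SUP f\<in>{f\<in>X. NX f \<le> 1}. NY (\<lambda>x. f x - A f x)) | A.
      (\<forall>f\<in>X. A f \<in> Y) \<and> lin_on X A \<and> bounded_op X NX NY A \<and> rank_less X A n}"

end

theory Submission
  imports Defs
begin

text \<open>Upper bound: keep the \<open>n - 1\<close> Fourier terms of smallest weight and apply
  Cauchy--Schwarz to the remaining coefficients. The sup norm is dominated by the Wiener norm because
  an integrable function with vanishing Fourier coefficients is zero almost everywhere.

  Lower bound: let \<open>A\<close> have rank less than \<open>n\<close>. Among the characters belonging to
  \<open>\<sigma> 1, \<dots>, \<sigma> N\<close>, the operator annihilates functions \<open>f 1, \<dots>, f m\<close>, orthonormal in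
  \<open>F_space w\<close>, with \<open>m = N - n + 1\<close>. On unit combinations of these the error of \<open>A\<close> is the sup norm
  itself, so \<open>\<Sum>l\<le>m. \<bar>f l x\<bar>\<^sup>2\<close> is at most the squared error at every \<open>x\<close>. Integrating over the
  torus gives a weighted sum of the \<open>(\<sigma> j)\<^sup>2\<close> with weights in \<open>[0,1]\<close> of total mass \<open>m\<close>, which is
  smallest when the weights sit on \<open>\<sigma> n, \<dots>, \<sigma> N\<close>.\<close>

section \<open>Orthonormal solutions of homogeneous systems\<close>

text \<open>On \<open>F_space w\<close> each of the three target norms lies between
  \<open>Linf_norm\<close> and \<open>Wiener_norm\<close>, so one argument serves all targets.
  Nothing is lost between the two ends because characters have modulus 1: averaging the squared
  modulus of a character sum returns its squared coefficients, whatever combinations the unknown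
  operator happens to annihilate. The number m = N - n + 1 is the count of N unknowns minus at most
  n - 1 linear conditions. The averaging weights are the diagonal of the orthogonal projection onto
  the coefficient vectors, which explains both the range [0,1] and the trace m. Letting N grow then
  gives the full tail. The obstacle in the lower bound is that the extremal combination at x depends
  on x, and essential bounds for all combinations would leave uncountably many null sets. Continuity
  of the combinations turns each bound into one at every point of the open cube. The obstacle in the
  upper bound is that a member of \<open>F_space w\<close> is only known to be integrable. It has to
  be identified almost everywhere with its Fourier series, and the uniqueness behind this comes from
  Stone-Weierstrass on a product of circles.\<close>

lemma homogeneous_system_nontrivial_solution:
  fixes c :: "'e \<Rightarrow> 'k \<Rightarrow> complex"
  assumes "finite E" "finite K" "card E < card K"
  shows "\<exists>u. (\<exists>k\<in>K. u k \<noteq> 0) \<and> (\<forall>e\<in>E. (\<Sum>k\<in>K. c e k * u k) = 0)"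
  using assms
proof (induction E arbitrary: K c rule: finite_induct)
  case empty
  then have "K \<noteq> {}" by auto
  then show ?case by (intro exI[of _ "\<lambda>_. 1"]) auto
next
  case (insert e E)
  show ?case
  proof (cases "\<exists>p\<in>K. c e p \<noteq> 0")
    case False
    have "card E < card K" using insert by auto
    then obtain u where "\<exists>k\<in>K. u k \<noteq> 0" "\<forall>e\<in>E. (\<Sum>k\<in>K. c e k * u k) = 0"
      using insert.IH[of K c] insert.prems by blast
    with False show ?thesis by (intro exI[of _ u]) auto
  next
    case True
    then obtain p where p: "p \<in> K" "c e p \<noteq> 0" by blast
    \<comment> \<open>Gaussian elimination with pivot \<open>c e p\<close>: subtracting a multiple
      of row \<open>e\<close> removes the unknown at \<open>p\<close> from every other row. Row
      \<open>e\<close> itself is satisfied afterwards by the choice of \<open>v p\<close>.\<close>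
    define c' where "c' = (\<lambda>e' k. c e' k - c e' p * c e k / c e p)"
    have "card E < card (K - {p})" using insert p by auto
    then obtain u where u: "\<exists>k\<in>K - {p}. u k \<noteq> 0"
      "\<forall>e'\<in>E. (\<Sum>k\<in>K - {p}. c' e' k * u k) = 0"
      using insert.IH[of "K - {p}" c'] insert.prems by blast
    define s where "s = (\<Sum>k\<in>K - {p}. c e k * u k)"
    define v where "v = u(p := - s / c e p)"
    have split: "(\<Sum>k\<in>K. c e' k * v k) = c e' p * v p + (\<Sum>k\<in>K - {p}. c e' k * u k)" for e'
      using insert.prems p by (subst sum.remove[of _ p]) (auto simp: v_def intro!: sum.cong)
    have "(\<Sum>k\<in>K. c e k * v k) = 0"
      unfolding split using p by (simp add: v_def s_def)
    moreover have "(\<Sum>k\<in>K. c e' k * v k) = 0" if "e' \<in> E" for e'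
    proof -
      have "0 = (\<Sum>k\<in>K - {p}. c' e' k * u k)" using u that by simp
      also have "\<dots> = (\<Sum>k\<in>K - {p}. c e' k * u k) - c e' p / c e p * s"
        by (simp add: c'_def s_def algebra_simps sum_subtractf sum_distrib_left sum_divide_distrib)
      finally show ?thesis unfolding split by (simp add: v_def)
    qed
    moreover have "\<exists>k\<in>K. v k \<noteq> 0" using u by (auto simp: v_def)
    ultimately show ?thesis by (intro exI[of _ v]) auto
  qed
qed

definition orthonormal_on :: "'k set \<Rightarrow> nat \<Rightarrow> (nat \<Rightarrow> 'k \<Rightarrow> complex) \<Rightarrow> bool" where
  "orthonormal_on K m u \<longleftrightarrow>
    (\<forall>i<m. \<forall>j<m. (\<Sum>k\<in>K. u i k * cnj (u j k)) = of_bool (i = j))"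

text \<open>Orthogonality to the vectors already found is again a homogeneous linear condition. The
  next vector therefore solves one system with \<open>card E + m\<close> equations, indexed by a sum
  type, and only has to be normalized.\<close>

lemma orthonormal_solutions_exist:
  fixes c :: "'e \<Rightarrow> 'k \<Rightarrow> complex"
  assumes "finite E" "finite K" "card E + m \<le> card K"
  shows "\<exists>u. orthonormal_on K m u \<and> (\<forall>l<m. \<forall>e\<in>E. (\<Sum>k\<in>K. c e k * u l k) = 0)"
  using assms(3)
proof (induction m)
  case 0
  then show ?case by (auto simp: orthonormal_on_def)
next
  case (Suc m)
  then obtain u where u: "orthonormal_on K m u"
    "\<forall>l<m. \<forall>e\<in>E. (\<Sum>k\<in>K. c e k * u l k) = 0" by auto
  define d where "d = (\<lambda>x k. case x of Inl e \<Rightarrow> c e k | Inr i \<Rightarrow> cnj (u i k))"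
  have "card (E <+> {..<m}) < card K" using Suc.prems assms by (simp add: card_Plus)
  then obtain y where y: "\<exists>k\<in>K. y k \<noteq> 0" "\<forall>x\<in>E <+> {..<m}. (\<Sum>k\<in>K. d x k * y k) = 0"
    using homogeneous_system_nontrivial_solution[of "E <+> {..<m}" K d] assms by auto
  define r where "r = sqrt (\<Sum>k\<in>K. (cmod (y k))\<^sup>2)"
  have pos: "(\<Sum>k\<in>K. (cmod (y k))\<^sup>2) > 0" using y(1) assms by (auto intro!: sum_pos2)
  then have r: "r > 0" "r\<^sup>2 = (\<Sum>k\<in>K. (cmod (y k))\<^sup>2)" by (auto simp: r_def)
  define v where "v = (\<lambda>k. y k / of_real r)"
  have vE: "(\<Sum>k\<in>K. c e k * v k) = 0" if "e \<in> E" for e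
  proof -
    have "(\<Sum>k\<in>K. d (Inl e) k * y k) = 0" using y(2) that by blast
    then show ?thesis by (simp add: v_def d_def sum_divide_distrib[symmetric])
  qed
  have vu: "(\<Sum>k\<in>K. v k * cnj (u i k)) = 0" if "i < m" for i
  proof -
    have "(\<Sum>k\<in>K. d (Inr i) k * y k) = 0" using y(2) that by blast
    then show ?thesis by (simp add: v_def d_def sum_divide_distrib[symmetric] mult.commute)
  qed
  have uv: "(\<Sum>k\<in>K. u i k * cnj (v k)) = 0" if "i < m" for i
    using arg_cong[OF vu[OF that], of cnj] by (simp add: mult.commute)
  have "(\<Sum>k\<in>K. v k * cnj (v k)) = of_real (\<Sum>k\<in>K. (cmod (y k))\<^sup>2) / (of_real r)\<^sup>2"
    by (simp add: v_def sum_divide_distrib complex_norm_square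
        power2_eq_square[of "complex_of_real r"] del: of_real_power)
  also have "\<dots> = 1" using r by (simp flip: r(2) of_real_power)
  finally have vv: "(\<Sum>k\<in>K. v k * cnj (v k)) = 1" .
  show ?case
  proof (intro exI[of _ "u(m := v)"] conjI)
    show "orthonormal_on K (Suc m) (u(m := v))"
      using u(1) vu uv vv by (auto simp: orthonormal_on_def less_Suc_eq)
    show "\<forall>l<Suc m. \<forall>e\<in>E. (\<Sum>k\<in>K. c e k * (u(m := v)) l k) = 0"
      using u(2) vE by (auto simp: less_Suc_eq)
  qed
qed

lemma orthonormal_on_norm:
  assumes "orthonormal_on K m u" "l < m"
  shows "(\<Sum>k\<in>K. (cmod (u l k))\<^sup>2) = 1"
proof -
  have "of_real (\<Sum>k\<in>K. (cmod (u l k))\<^sup>2) = (\<Sum>k\<in>K. u l k * cnj (u l k))"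
    by (simp only: of_real_sum complex_norm_square)
  also have "\<dots> = of_real 1" using assms by (simp add: orthonormal_on_def)
  finally show ?thesis by (simp only: of_real_eq_iff)
qed

text \<open>Pythagoras: after expanding the square, the cross terms vanish. It serves both for
  Bessel's inequality and for computing \<open>F_norm\<close> of combinations in the lower
  bound.\<close>

lemma orthonormal_on_norm_sum:
  assumes "orthonormal_on K m u"
  shows "(\<Sum>k\<in>K. (cmod (\<Sum>l<m. a l * u l k))\<^sup>2) = (\<Sum>l<m. (cmod (a l))\<^sup>2)"
proof -
  have "of_real (\<Sum>k\<in>K. (cmod (\<Sum>l<m. a l * u l k))\<^sup>2)
      = (\<Sum>k\<in>K. \<Sum>i<m. \<Sum>j<m. a i * cnj (a j) * (u i k * cnj (u j k)))"
    by (simp only: of_real_sum complex_norm_square cnj_sum sum_product)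
       (simp add: mult_ac)
  also have "\<dots> = (\<Sum>i<m. \<Sum>j<m. a i * cnj (a j) * (\<Sum>k\<in>K. u i k * cnj (u j k)))"
    by (subst sum.swap, intro sum.cong refl, subst sum.swap) (simp add: sum_distrib_left)
  also have "\<dots> = (\<Sum>i<m. \<Sum>j<m. if i = j then a i * cnj (a j) else 0)"
    using assms by (intro sum.cong refl) (simp add: orthonormal_on_def)
  also have "\<dots> = of_real (\<Sum>l<m. (cmod (a l))\<^sup>2)"
    by (simp only: of_real_sum complex_norm_square) simp
  finally show ?thesis by (simp only: of_real_eq_iff)
qed

text \<open>Bessel's inequality for the unit vector at \<open>k\<close>.\<close>

lemma orthonormal_on_coordinate_le_1:
  assumes "orthonormal_on K m u" "finite K" "k \<in> K"
  shows "(\<Sum>l<m. (cmod (u l k))\<^sup>2) \<le> 1"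
proof -
  define s where "s = (\<Sum>l<m. (cmod (u l k))\<^sup>2)"
  \<comment> \<open>The projection of the unit vector at \<open>k\<close> onto the span of the
    \<open>u l\<close>. Its value at \<open>k\<close> and its squared norm both equal
    \<open>s\<close>, whence \<open>s * s\<close> is at most \<open>s\<close>.\<close>
  define z where "z = (\<lambda>j. \<Sum>l<m. cnj (u l k) * u l j)"
  have zk: "z k = of_real s"
    by (simp add: z_def s_def complex_norm_square mult.commute del: of_real_power)
  have "s\<^sup>2 = (cmod (z k))\<^sup>2" by (simp add: zk)
  also have "\<dots> \<le> (\<Sum>j\<in>K. (cmod (z j))\<^sup>2)" using assms by (intro member_le_sum) auto
  also have "\<dots> = s"
    unfolding z_def by (subst orthonormal_on_norm_sum[OF assms(1)]) (simp add: s_def)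
  finally have "s * s \<le> s * 1" by (simp add: power2_eq_square)
  moreover have "s \<ge> 0" by (simp add: s_def sum_nonneg)
  ultimately show ?thesis unfolding s_def[symmetric]
    by (metis mult_le_cancel_left_pos not_le order.strict_trans1 zero_less_one order_le_less)
qed

text \<open>Both \<open>s k - s n\<close> and \<open>q k - of_bool (n \<le> k)\<close> are
  nonnegative for k < n and nonpositive from n on, so their products are nonnegative. Since
  \<open>q\<close> and the indicator have the same total, the contribution of the constant
  \<open>s n\<close> cancels in the sum.\<close>

lemma antimono_weighted_sum_ge_tail:
  fixes s q :: "nat \<Rightarrow> real"
  assumes "1 \<le> n" "n \<le> N"
    and s: "\<And>i j. 1 \<le> i \<Longrightarrow> i \<le> j \<Longrightarrow> s j \<le> s i"
    and q: "\<And>k. k \<in> {1..N} \<Longrightarrow> 0 \<le> q k \<and> q k \<le> 1"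
    and total: "(\<Sum>k=1..N. q k) = real (Suc N - n)"
  shows "(\<Sum>k=n..N. s k) \<le> (\<Sum>k=1..N. s k * q k)"
proof -
  have tail: "(\<Sum>k=1..N. f k * of_bool (n \<le> k)) = (\<Sum>k=n..N. f k)" for f :: "nat \<Rightarrow> real"
    using assms(1) by (intro sum.mono_neutral_cong_right) auto
  have "0 \<le> (\<Sum>k=1..N. (s k - s n) * (q k - of_bool (n \<le> k)))"
  proof (intro sum_nonneg)
    fix k assume k: "k \<in> {1..N}"
    show "0 \<le> (s k - s n) * (q k - of_bool (n \<le> k))"
    proof (cases "n \<le> k")
      case True
      then show ?thesis using q[OF k] s[of n k] assms(1) by (intro mult_nonpos_nonpos) auto
    next
      case False
      then show ?thesis using q[OF k] s[of k n] k by (intro mult_nonneg_nonneg) auto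
    qed
  qed
  also have "\<dots> = (\<Sum>k=1..N. s k * q k) - (\<Sum>k=1..N. s k * of_bool (n \<le> k))
      - s n * ((\<Sum>k=1..N. q k) - (\<Sum>k=1..N. 1 * of_bool (n \<le> k)))"
    by (simp only: mult_1 left_diff_distrib right_diff_distrib sum_subtractf sum_distrib_left)
  also have "\<dots> = (\<Sum>k=1..N. s k * q k) - (\<Sum>k=n..N. s k)"
    unfolding tail total by simp
  finally show ?thesis by simp
qed

section \<open>Characters of the torus\<close>

definition fourier_char :: "int^'n \<Rightarrow> real^'n \<Rightarrow> complex" where
  "fourier_char k x = exp (\<i> * complex_of_real (kdot k x))"

lemma kdot_add_index: "kdot (k + m) x = kdot k x + kdot m x"
  by (simp add: kdot_def algebra_simps sum.distrib)

lemma kdot_minus_index: "kdot (- k) x = - kdot k x"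
  by (simp add: kdot_def sum_negf)

lemma kdot_add: "kdot k (x + y) = kdot k x + kdot k y"
  by (simp add: kdot_def algebra_simps sum.distrib)

lemma kdot_axis: "kdot k (r *\<^sub>R axis i 1) = of_int (k $ i) * r"
proof -
  have "kdot k (r *\<^sub>R axis i 1) = (\<Sum>j\<in>UNIV. if j = i then of_int (k $ j) * r else 0)"
    unfolding kdot_def by (intro sum.cong) (auto simp: axis_def)
  then show ?thesis by simp
qed

lemma fourier_char_mult: "fourier_char k x * fourier_char m x = fourier_char (k + m) x"
  by (simp add: fourier_char_def kdot_add_index exp_add algebra_simps)

lemma cnj_fourier_char: "cnj (fourier_char k x) = fourier_char (- k) x"
  by (simp add: fourier_char_def kdot_minus_index exp_cnj)

lemma fourier_char_0 [simp]: "fourier_char 0 x = 1"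
  by (simp add: fourier_char_def kdot_def)

lemma norm_fourier_char [simp]: "cmod (fourier_char k x) = 1"
  by (simp add: fourier_char_def)

lemma continuous_on_fourier_char [continuous_intros]: "continuous_on S (fourier_char k)"
  unfolding fourier_char_def kdot_def by (intro continuous_intros)

lemma fourier_coeff_eq: "fourier_coeff f k = torus_int (\<lambda>x. f x * fourier_char (- k) x)"
  by (simp add: fourier_coeff_def fourier_char_def kdot_minus_index)

lemma torus_periodic_fourier_char: "torus_periodic (fourier_char k)"
  unfolding torus_periodic_def
proof (intro allI)
  fix x i
  have "exp (\<i> * complex_of_real (of_int (k $ i) * (2 * pi))) = 1"
    using exp_integer_2pi[of "of_int (k $ i)"] by (simp add: algebra_simps)
  then show "fourier_char k (x + (2 * pi) *\<^sub>R axis i 1) = fourier_char k x"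
    unfolding fourier_char_def kdot_add kdot_axis of_real_add distrib_left exp_add by simp
qed

lemma borel_measurable_fourier_char [measurable]: "fourier_char k \<in> borel_measurable borel"
  by (intro borel_measurable_continuous_onI continuous_on_fourier_char)

lemma torus_cube_borel [measurable]: "torus_cube \<in> sets borel"
proof -
  have "torus_cube = (\<Inter>i. {x::real^'n. 0 \<le> x $ i} \<inter> {x. x $ i < 2 * pi})"
    by (auto simp: torus_cube_def)
  also have "\<dots> \<in> sets borel"
    by (intro sets.finite_INT) (auto intro!: sets.Int borel_closed borel_open
      closed_Collect_le open_Collect_less continuous_intros)
  finally show ?thesis .
qed

lemma bounded_torus_cube: "bounded (torus_cube :: (real^'n) set)"
proof -
  have "torus_cube \<subseteq> cbox (0 :: real^'n) (\<chi> i. 2 * pi)"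
    by (auto simp: torus_cube_def mem_box_cart less_imp_le)
  then show ?thesis using bounded_cbox bounded_subset by blast
qed

lemma torus_cube_lmeasurable: "torus_cube \<in> lmeasurable"
  by (intro bounded_set_imp_lmeasurable bounded_torus_cube) simp

lemma character_integral_circle:
  "(\<integral>t. indicator {0..<2*pi} t *\<^sub>R exp (\<i> * of_int m * of_real t) \<partial>lborel)
     = (if m = 0 then of_real (2 * pi) else 0)"
  "integrable lborel (\<lambda>t. indicator {0..<2*pi} t *\<^sub>R exp (\<i> * of_int m * complex_of_real t))"
proof -
  let ?e = "\<lambda>t. exp (\<i> * of_int m * complex_of_real t)"
  have cont: "continuous_on {0..2*pi} ?e" by (intro continuous_intros)
  \<comment> \<open>The half-open interval is replaced by the closed one, where the fundamental
    theorem of calculus applies; they differ in a single point.\<close>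
  have "AE t in lborel. t \<noteq> 2 * pi"
    by (simp add: AE_lborel_singleton)
  then have ae: "AE t in lborel. indicator {0..<2*pi} t *\<^sub>R ?e t = indicator {0..2*pi} t *\<^sub>R ?e t"
    by eventually_elim (auto simp: indicator_def)
  have int: "integrable lborel (\<lambda>t. indicator {0..2*pi} t *\<^sub>R ?e t)"
    using borel_integrable_compact[OF compact_Icc cont] by (simp add: indicator_scaleR_eq_if)
  show "integrable lborel (\<lambda>t. indicator {0..<2*pi} t *\<^sub>R ?e t)"
    by (subst integrable_cong_AE[OF _ _ ae]) (use int in \<open>auto\<close>)
  have "(\<integral>t. indicator {0..<2*pi} t *\<^sub>R ?e t \<partial>lborel) = (\<integral>t. indicator {0..2*pi} t *\<^sub>R ?e t \<partial>lborel)"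
    by (intro integral_cong_AE ae) auto
  also have "\<dots> = (if m = 0 then of_real (2 * pi) else 0)"
  proof (cases "m = 0")
    case True
    then have "(\<integral>t. indicator {0..2*pi} t *\<^sub>R ?e t \<partial>lborel) = of_real (2 * pi) - of_real 0"
      by (intro integral_FTC_atLeastAtMost cont) (auto intro!: derivative_eq_intros)
    then show ?thesis using True by simp
  next
    case False
    let ?F = "\<lambda>t. ?e t / (\<i> * of_int m)"
    have "(\<integral>t. indicator {0..2*pi} t *\<^sub>R ?e t \<partial>lborel) = ?F (2 * pi) - ?F 0"
      using False
      by (intro integral_FTC_atLeastAtMost cont has_vector_derivative_real_field)
         (auto intro!: derivative_eq_intros)
    also have "?e (2 * pi) = 1"
      using exp_integer_2pi[of "of_int m"] by (simp add: algebra_simps)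
    finally show ?thesis using False by simp
  qed
  finally show "(\<integral>t. indicator {0..<2*pi} t *\<^sub>R ?e t \<partial>lborel) = (if m = 0 then of_real (2 * pi) else 0)" .
qed

text \<open>Fubini for products of one-variable functions, by viewing \<open>lborel\<close> as the
  image of a product measure under the basis expansion.\<close>

lemma integral_lborel_prod:
  fixes f :: "'a::euclidean_space \<Rightarrow> real \<Rightarrow> complex"
  assumes "\<And>b. b \<in> Basis \<Longrightarrow> integrable lborel (f b)"
  shows "(\<integral>x. (\<Prod>b\<in>Basis. f b (x \<bullet> b)) \<partial>lborel) = (\<Prod>b\<in>Basis. \<integral>t. f b t \<partial>lborel)"
proof -
  have [measurable]: "f b \<in> borel_measurable borel" if "b \<in> Basis" for b
    using borel_measurable_integrable[OF assms[OF that]] by simp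
  interpret product_sigma_finite "\<lambda>_::'a. lborel :: real measure"
    by unfold_locales
  have "(\<integral>x. (\<Prod>b\<in>Basis. f b (x \<bullet> b)) \<partial>lborel)
      = (\<integral>y. (\<Prod>b\<in>Basis. f b ((\<Sum>c\<in>Basis. y c *\<^sub>R c) \<bullet> b)) \<partial>(\<Pi>\<^sub>M b\<in>(Basis::'a set). lborel))"
    by (subst lborel_eq, subst integral_distr) auto
  also have "\<dots> = (\<integral>y. (\<Prod>b\<in>Basis. f b (y b)) \<partial>(\<Pi>\<^sub>M b\<in>(Basis::'a set). lborel))"
    by (simp add: inner_sum_left_Basis)
  also have "\<dots> = (\<Prod>b\<in>Basis. \<integral>t. f b t \<partial>lborel)"
    by (intro product_integral_prod assms) auto
  finally show ?thesis .
qed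

lemma torus_int_fourier_char: "torus_int (fourier_char (m :: int^'n)) = of_bool (m = 0)"
proof -
  \<comment> \<open>Each factor carries the indicator of its own side, so that the indicator of the
    cube is absorbed into the product. \<open>axis_index\<close> recovers the coordinate from the
    basis vector.\<close>
  define f where "f = (\<lambda>b::real^'n. \<lambda>t::real. indicator {0..<2*pi} t *\<^sub>R
    exp (\<i> * of_int (m $ axis_index b) * complex_of_real t))"
  have reidx: "(\<Prod>b\<in>(Basis::(real^'n) set). F b) = (\<Prod>i\<in>UNIV. F (axis i 1))" for F :: "real^'n \<Rightarrow> complex"
    using prod.reindex[of "\<lambda>i::'n. axis i (1::real)" UNIV F]
    by (simp add: Basis_vec_def inj_on_def axis_eq_axis UNION_singleton_eq_range)
  have *: "indicator torus_cube x *\<^sub>R fourier_char m x = (\<Prod>b\<in>Basis. f b (x \<bullet> b))" for x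
  proof (cases "x \<in> torus_cube")
    case True
    then show ?thesis
      by (auto simp: reidx f_def axis_index_axis torus_cube_def fourier_char_def kdot_def
          indicator_def cart_eq_inner_axis[symmetric] sum_distrib_left exp_sum algebra_simps)
  next
    case False
    then obtain i where "\<not> (0 \<le> x $ i \<and> x $ i < 2 * pi)" by (auto simp: torus_cube_def)
    then have "f (axis i 1) (x \<bullet> axis i 1) = 0"
      by (auto simp: f_def cart_eq_inner_axis[symmetric])
    then show ?thesis using False by (auto simp: reidx)
  qed
  have "(LINT x:torus_cube|lebesgue. fourier_char m x)
      = (\<integral>x. indicator torus_cube x *\<^sub>R fourier_char m x \<partial>lborel)"
    unfolding set_lebesgue_integral_def by (intro integral_completion) simp
  also have "\<dots> = (\<Prod>b\<in>Basis. \<integral>t. f b t \<partial>lborel)"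
    unfolding * by (intro integral_lborel_prod) (simp add: f_def character_integral_circle)
  also have "\<dots> = (\<Prod>i\<in>UNIV. if m $ i = 0 then of_real (2 * pi) else 0)"
    by (simp add: reidx f_def axis_index_axis character_integral_circle)
  also have "\<dots> = of_bool (m = 0) * of_real ((2 * pi) ^ CARD('n))"
    by (auto simp: vec_eq_iff)
  finally show ?thesis unfolding torus_int_def by simp
qed

section \<open>Uniqueness of Fourier coefficients\<close>

lemma set_integrable_mult_bounded:
  fixes f g :: "'a::euclidean_space \<Rightarrow> complex"
  assumes f: "set_integrable lebesgue A f"
    and g: "g \<in> borel_measurable lebesgue" and bound: "\<And>x. x \<in> A \<Longrightarrow> cmod (g x) \<le> C"
  shows "set_integrable lebesgue A (\<lambda>x. f x * g x)"
  unfolding set_integrable_def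
proof (rule Bochner_Integration.integrable_bound)
  show "integrable lebesgue (\<lambda>x. C *\<^sub>R (indicator A x *\<^sub>R f x))"
    using f unfolding set_integrable_def by (rule integrable_scaleR_right)
  have "(\<lambda>x. indicator A x *\<^sub>R f x) \<in> borel_measurable lebesgue"
    using f unfolding set_integrable_def by (rule borel_measurable_integrable)
  from borel_measurable_times[OF this g]
  show "(\<lambda>x. indicator A x *\<^sub>R (f x * g x)) \<in> borel_measurable lebesgue"
    by (simp only: mult_scaleR_left)
  show "AE x in lebesgue. norm (indicator A x *\<^sub>R (f x * g x)) \<le> norm (C *\<^sub>R (indicator A x *\<^sub>R f x))"
  proof (intro AE_I2)
    fix x
    show "norm (indicator A x *\<^sub>R (f x * g x)) \<le> norm (C *\<^sub>R (indicator A x *\<^sub>R f x))"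
    proof (cases "x \<in> A")
      case True
      then have "cmod (f x) * cmod (g x) \<le> cmod (f x) * \<bar>C\<bar>"
        using bound[OF True] by (intro mult_left_mono) auto
      with True show ?thesis by (simp add: norm_mult mult.commute)
    qed auto
  qed
qed

lemma set_integrable_torus_bounded:
  fixes g :: "real^'n \<Rightarrow> complex"
  assumes "g \<in> borel_measurable lebesgue" "\<And>x. x \<in> torus_cube \<Longrightarrow> cmod (g x) \<le> C"
  shows "set_integrable lebesgue torus_cube g"
proof -
  have "set_integrable lebesgue (torus_cube :: (real^'n) set) (\<lambda>x. 1 :: complex)"
    using torus_cube_lmeasurable unfolding set_integrable_def fmeasurable_def
    by (auto simp: integrable_indicator_iff intro!: integrable_scaleR_left)
  from set_integrable_mult_bounded[OF this assms] show ?thesis by simp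
qed

lemma continuous_imp_borel_lebesgue:
  fixes g :: "'a::euclidean_space \<Rightarrow> 'b::euclidean_space"
  shows "continuous_on UNIV g \<Longrightarrow> g \<in> borel_measurable lebesgue"
  by (intro measurable_completion) (simp add: borel_measurable_continuous_onI)

lemma fourier_char_lebesgue [measurable]: "fourier_char k \<in> borel_measurable lebesgue"
  by (intro continuous_imp_borel_lebesgue continuous_on_fourier_char)

lemma set_integrable_mult_fourier_char:
  "set_integrable lebesgue A f \<Longrightarrow> set_integrable lebesgue A (\<lambda>x. f x * fourier_char k x)"
  by (rule set_integrable_mult_bounded[where C = 1]) auto

lemma torus_int_add:
  assumes "set_integrable lebesgue torus_cube f" "set_integrable lebesgue torus_cube g"
  shows "torus_int (\<lambda>x. f x + g x) = torus_int f + torus_int g"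
  using assms by (simp add: torus_int_def set_integral_add distrib_left)

lemma torus_int_mult_right: "torus_int (\<lambda>x. c * f x) = c * torus_int f"
  by (simp add: torus_int_def)

lemma torus_int_sum:
  assumes "\<And>i. i \<in> I \<Longrightarrow> set_integrable lebesgue torus_cube (f i)"
  shows "torus_int (\<lambda>x. \<Sum>i\<in>I. f i x) = (\<Sum>i\<in>I. torus_int (f i))"
proof -
  have "(LINT x:torus_cube|lebesgue. \<Sum>i\<in>I. f i x) = (\<Sum>i\<in>I. LINT x:torus_cube|lebesgue. f i x)"
    unfolding set_lebesgue_integral_def scaleR_sum_right
    using assms by (intro Bochner_Integration.integral_sum) (simp add: set_integrable_def)
  then show ?thesis by (simp only: torus_int_def sum_distrib_left)
qed

text \<open>Orthogonality at frequency 0 already contains the volume, since that character is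
  constantly 1.\<close>

lemma measure_torus_cube: "measure lebesgue (torus_cube :: (real^'n) set) = (2 * pi) ^ CARD('n)"
proof -
  have "torus_int (fourier_char (0 :: int^'n)) = 1"
    using torus_int_fourier_char[of "0 :: int^'n"] by simp
  then have "complex_of_real (1 / (2*pi) ^ CARD('n) * measure lebesgue (torus_cube :: (real^'n) set)) = of_real 1"
    using torus_cube_lmeasurable
    by (simp add: torus_int_def set_lebesgue_integral_def scaleR_conv_of_real lmeasurable_iff_integrable)
  then have "1 / (2*pi) ^ CARD('n) * measure lebesgue (torus_cube :: (real^'n) set) = 1"
    by (simp only: of_real_eq_iff)
  then show ?thesis by (simp add: field_simps)
qed

lemma norm_torus_int_le:
  fixes f :: "real^'n \<Rightarrow> complex"
  assumes f: "set_integrable lebesgue torus_cube f"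
    and bound: "AE x in lebesgue. x \<in> torus_cube \<longrightarrow> cmod (f x) \<le> M"
  shows "cmod (torus_int f) \<le> M"
proof -
  have "cmod (LINT x:torus_cube|lebesgue. f x) \<le> (\<integral>x. cmod (indicator torus_cube x *\<^sub>R f x) \<partial>lebesgue)"
    unfolding set_lebesgue_integral_def by (rule integral_norm_bound)
  also have "\<dots> \<le> (\<integral>x. indicator (torus_cube :: (real^'n) set) x * M \<partial>lebesgue)"
  proof (rule integral_mono_AE)
    show "integrable lebesgue (\<lambda>x. cmod (indicator torus_cube x *\<^sub>R f x))"
      using f unfolding set_integrable_def by (rule integrable_norm)
    show "integrable lebesgue (\<lambda>x::real^'n. indicator torus_cube x * M)"
      using torus_cube_lmeasurable by (intro integrable_mult_left) (simp add: lmeasurable_iff_integrable)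
    show "AE x in lebesgue. norm (indicator torus_cube x *\<^sub>R f x) \<le> indicator torus_cube x * M"
      using bound by eventually_elim (auto simp: indicator_def)
  qed
  also have "\<dots> = (2 * pi) ^ CARD('n) * M"
    by (simp add: measure_torus_cube)
  finally show ?thesis by (simp add: torus_int_def norm_mult norm_divide norm_power field_simps)
qed

section \<open>The algebra of trigonometric polynomials\<close>

inductive trig_poly :: "(real^'n \<Rightarrow> complex) \<Rightarrow> bool" where
  char: "trig_poly (fourier_char k)"
| add: "trig_poly p \<Longrightarrow> trig_poly q \<Longrightarrow> trig_poly (\<lambda>x. p x + q x)"
| scale: "trig_poly p \<Longrightarrow> trig_poly (\<lambda>x. c * p x)"

lemma trig_poly_const: "trig_poly (\<lambda>x. c)"
  using trig_poly.scale[OF trig_poly.char[of 0], of c] by simp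

lemma trig_poly_sum: "(\<And>i. i \<in> I \<Longrightarrow> trig_poly (p i)) \<Longrightarrow> trig_poly (\<lambda>x. \<Sum>i\<in>I. p i x)"
  by (induction I rule: infinite_finite_induct) (auto intro: trig_poly_const trig_poly.add)

text \<open>Closure under products is what allows polynomials in the coordinates of
  \<open>torus_embedding\<close> to be treated as trigonometric polynomials.\<close>

lemma trig_poly_mult:
  assumes "trig_poly p" "trig_poly q"
  shows "trig_poly (\<lambda>x. p x * q x)"
  using assms(1)
proof induction
  case (char k)
  show ?case using assms(2)
  proof induction
    case (char m)
    then show ?case by (simp add: fourier_char_mult trig_poly.char)
  qed (auto simp: distrib_left mult.left_commute intro: trig_poly.intros)
qed (auto simp: distrib_right mult.assoc intro: trig_poly.intros)

lemma trig_poly_cnj: "trig_poly p \<Longrightarrow> trig_poly (\<lambda>x. cnj (p x))"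
  by (induction rule: trig_poly.induct) (simp_all add: cnj_fourier_char trig_poly.intros)

lemma trig_poly_continuous: "trig_poly p \<Longrightarrow> continuous_on UNIV p"
  by (induction rule: trig_poly.induct) (auto intro!: continuous_intros)

lemma trig_poly_periodic: "trig_poly p \<Longrightarrow> torus_periodic p"
  by (induction rule: trig_poly.induct)
     (use torus_periodic_fourier_char in \<open>auto simp: torus_periodic_def\<close>)

lemma trig_poly_bounded: "trig_poly p \<Longrightarrow> \<exists>C. \<forall>x. cmod (p x) \<le> C"
proof (induction rule: trig_poly.induct)
  case (add p q)
  then obtain C D where "\<forall>x. cmod (p x) \<le> C" "\<forall>x. cmod (q x) \<le> D" by auto
  then have "cmod (p x + q x) \<le> C + D" for x by (meson add_mono norm_triangle_le)
  then show ?case by blast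
next
  case (scale p c)
  then obtain C where "\<forall>x. cmod (p x) \<le> C" by auto
  then have "cmod (c * p x) \<le> cmod c * C" for x by (auto simp: norm_mult intro: mult_left_mono)
  then show ?case by blast
qed (auto intro!: exI[of _ 1])

lemma trig_poly_integrable_mult:
  assumes "set_integrable lebesgue A f" "trig_poly p"
  shows "set_integrable lebesgue A (\<lambda>x. f x * p x)"
  using set_integrable_mult_bounded[OF assms(1)] trig_poly_bounded[OF assms(2)]
    continuous_imp_borel_lebesgue[OF trig_poly_continuous[OF assms(2)]] by blast

lemma torus_int_trig_poly_zero:
  assumes f: "set_integrable lebesgue torus_cube f" "\<And>k. fourier_coeff f k = 0"
    and p: "trig_poly p"
  shows "torus_int (\<lambda>x. f x * p x) = 0"
  using p
proof induction
  case (char k)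
  then show ?case using f(2)[of "- k"] by (simp add: fourier_coeff_eq)
next
  case (add p q)
  then show ?case
    using trig_poly_integrable_mult[OF f(1)] by (simp add: distrib_left torus_int_add)
next
  case (scale p c)
  then show ?case using torus_int_mult_right[of c "\<lambda>x. f x * p x"] by (simp add: mult.left_commute)
qed

text \<open>The point of the product of unit circles with angles x. Opposite faces of the closed
  cube are glued and its image is compact, so that Stone-Weierstrass applies there and yields
  periodic approximants.\<close>

definition torus_embedding :: "real^'n \<Rightarrow> complex^'n" where
  "torus_embedding x = (\<chi> i. fourier_char (axis i 1) x)"

lemma continuous_on_torus_embedding [continuous_intros]: "continuous_on S torus_embedding"
  unfolding torus_embedding_def by (intro continuous_intros)

text \<open>Two angles in the half-open range differ by less than a full turn, so equal exponentials
  force equal angles.\<close>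

lemma inj_on_torus_embedding: "inj_on torus_embedding torus_cube"
proof (rule inj_onI)
  fix x y :: "real^'n"
  assume x: "x \<in> torus_cube" and y: "y \<in> torus_cube" and eq: "torus_embedding x = torus_embedding y"
  have k: "kdot (axis i 1) z = z $ i" for i and z :: "real^'n"
  proof -
    have "kdot (axis i 1) z = (\<Sum>j\<in>UNIV. if j = i then z $ j else 0)"
      unfolding kdot_def by (intro sum.cong) (auto simp: axis_def)
    then show ?thesis by simp
  qed
  show "x = y"
    unfolding vec_eq_iff
  proof
    fix i
    have "torus_embedding x $ i = torus_embedding y $ i" using eq by simp
    then have "exp (\<i> * complex_of_real (x $ i)) = exp (\<i> * complex_of_real (y $ i))"
      by (simp add: torus_embedding_def fourier_char_def k)
    then show "x $ i = y $ i"
      using exp_complex_eqI[of "\<i> * complex_of_real (x $ i)" "\<i> * complex_of_real (y $ i)"] x y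
      by (auto simp: torus_cube_def abs_less_iff) (smt (verit))
  qed
qed

lemma trig_poly_Re: "trig_poly (\<lambda>x. of_real (Re (fourier_char k x)))"
proof -
  have "(\<lambda>x. of_real (Re (fourier_char k x))) = (\<lambda>x. 1/2 * (fourier_char k x + fourier_char (- k) x))"
    by (auto simp: cnj_fourier_char[symmetric] complex_eq_iff)
  then show ?thesis by (simp only:) (intro trig_poly.intros)
qed

lemma trig_poly_Im: "trig_poly (\<lambda>x. of_real (Im (fourier_char k x)))"
proof -
  have "(\<lambda>x. of_real (Im (fourier_char k x)))
      = (\<lambda>x. - \<i>/2 * (fourier_char k x + (- 1) * fourier_char (- k) x))"
    by (auto simp: cnj_fourier_char[symmetric] complex_eq_iff)
  then show ?thesis by (simp only:) (intro trig_poly.intros)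
qed

text \<open>Polynomial functions are generated from real-linear functionals. Such a functional is a
  combination of the real and imaginary parts of the coordinates, and these are half-sums and
  half-differences of opposite characters.\<close>

lemma trig_poly_of_real_polynomial:
  assumes "real_polynomial_function p"
  shows "trig_poly (\<lambda>x. of_real (p (torus_embedding x)))"
  using assms
proof induction
  case (linear L)
  interpret L: bounded_linear L by fact
  have z: "z = (\<Sum>i\<in>UNIV. Re (z $ i) *\<^sub>R axis i 1 + Im (z $ i) *\<^sub>R axis i \<i>)" for z :: "complex^'n"
  proof -
    have "(\<Sum>i\<in>UNIV. Re (z $ i) *\<^sub>R axis i 1 + Im (z $ i) *\<^sub>R axis i \<i>) $ j
        = (\<Sum>i\<in>UNIV. if i = j then z $ i else 0)" for j
      unfolding sum_component by (intro sum.cong) (auto simp: axis_def complex_eq_iff)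
    then show ?thesis by (simp add: vec_eq_iff)
  qed
  have L: "L z = (\<Sum>i\<in>UNIV. Re (z $ i) * L (axis i 1) + Im (z $ i) * L (axis i \<i>))" for z
    by (subst z) (simp only: L.sum L.add L.scaleR real_scaleR_def)
  have "(\<lambda>x. complex_of_real (L (torus_embedding x)))
     = (\<lambda>x. \<Sum>i\<in>UNIV. of_real (L (axis i 1)) * of_real (Re (fourier_char (axis i 1) x))
         + of_real (L (axis i \<i>)) * of_real (Im (fourier_char (axis i 1) x)))"
    by (rule ext, subst L) (simp add: torus_embedding_def mult.commute)
  then show ?case
    by (auto intro!: trig_poly_sum trig_poly.add trig_poly.scale trig_poly_Re trig_poly_Im)
qed (auto intro: trig_poly_const trig_poly.add trig_poly_mult)

text \<open>A polynomial close to \<open>F\<close> on the compact image of the closed cube gives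
  integral zero against \<open>f\<close>. The error is the uniform distance times the integral of
  the modulus of \<open>f\<close>, hence arbitrarily small.\<close>

lemma torus_int_continuous_zero:
  fixes f :: "real^'n \<Rightarrow> complex" and F :: "complex^'n \<Rightarrow> real"
  assumes f: "set_integrable lebesgue torus_cube f" "\<And>k. fourier_coeff f k = 0"
    and F: "continuous_on UNIV F"
  shows "torus_int (\<lambda>x. f x * of_real (F (torus_embedding x))) = 0"
proof -
  define S where "S = torus_embedding ` (cbox 0 (\<chi> i. 2 * pi) :: (real^'n) set)"
  have S: "compact S" unfolding S_def
    by (intro compact_continuous_image continuous_on_torus_embedding compact_cbox)
  have in_S: "torus_embedding x \<in> S" if "x \<in> torus_cube" for x :: "real^'n"
    using that by (auto simp: S_def torus_cube_def mem_box_cart less_imp_le)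
  have FS: "continuous_on S F" using F by (rule continuous_on_subset) auto
  have FE: "continuous_on UNIV (\<lambda>x. complex_of_real (F (torus_embedding x)))"
    by (intro continuous_intros continuous_on_compose2[OF F]) auto
  obtain C where C: "\<And>z. z \<in> S \<Longrightarrow> \<bar>F z\<bar> \<le> C"
    using compact_imp_bounded[OF compact_continuous_image[OF FS S]]
    by (auto simp: bounded_iff)
  have intF: "set_integrable lebesgue torus_cube (\<lambda>x. f x * of_real (F (torus_embedding x)))"
    by (rule set_integrable_mult_bounded[OF f(1) continuous_imp_borel_lebesgue[OF FE], of C])
       (use C in_S in auto)
  define I where "I = (\<integral>x. cmod (indicator torus_cube x *\<^sub>R f x) \<partial>lebesgue)"
  define J where "J = (LINT x:torus_cube|lebesgue. f x * of_real (F (torus_embedding x)))"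
  have I0: "I \<ge> 0" by (simp add: I_def)
  have "cmod J \<le> e" if "e > 0" for e
  proof -
    \<comment> \<open>The summand 1 covers the case that \<open>I\<close> vanishes.\<close>
    have e': "e / (I + 1) > 0" using that I0 by simp
    obtain p where p: "real_polynomial_function p" "\<And>z. z \<in> S \<Longrightarrow> \<bar>F z - p z\<bar> < e / (I + 1)"
      using Stone_Weierstrass_real_polynomial_function[OF S FS e'] by blast
    let ?p = "\<lambda>x. complex_of_real (p (torus_embedding x))"
    have tp: "trig_poly ?p" using p(1) by (rule trig_poly_of_real_polynomial)
    have intp: "set_integrable lebesgue torus_cube (\<lambda>x. f x * ?p x)"
      by (rule trig_poly_integrable_mult[OF f(1) tp])
    have "(LINT x:torus_cube|lebesgue. f x * ?p x) = 0"
      using torus_int_trig_poly_zero[OF f tp] by (simp add: torus_int_def)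
    then have "J = (LINT x:torus_cube|lebesgue. f x * of_real (F (torus_embedding x)) - f x * ?p x)"
      using intF intp by (simp add: J_def)
    also have "cmod \<dots> \<le> (\<integral>x. e / (I + 1) * cmod (indicator torus_cube x *\<^sub>R f x) \<partial>lebesgue)"
      unfolding set_lebesgue_integral_def
    proof (rule Bochner_Integration.integral_norm_bound_integral)
      show "integrable lebesgue (\<lambda>x. indicator torus_cube x *\<^sub>R
          (f x * of_real (F (torus_embedding x)) - f x * ?p x))"
        using set_integral_diff(1)[OF intF intp] by (simp add: set_integrable_def)
      show "integrable lebesgue (\<lambda>x. e / (I + 1) * cmod (indicator torus_cube x *\<^sub>R f x))"
        using f(1) unfolding set_integrable_def by (intro integrable_mult_right integrable_norm)
      fix x :: "real^'n"
      show "norm (indicator torus_cube x *\<^sub>R (f x * of_real (F (torus_embedding x)) - f x * ?p x))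
        \<le> e / (I + 1) * cmod (indicator torus_cube x *\<^sub>R f x)"
      proof (cases "x \<in> torus_cube")
        case True
        have "cmod (f x * of_real (F (torus_embedding x)) - f x * ?p x)
            = cmod (f x) * \<bar>F (torus_embedding x) - p (torus_embedding x)\<bar>"
          by (simp flip: right_diff_distrib of_real_diff add: norm_mult)
        also have "\<dots> \<le> cmod (f x) * (e / (I + 1))"
          using p(2)[OF in_S[OF True]] by (intro mult_left_mono) auto
        finally show ?thesis using True by (simp add: mult.commute)
      qed auto
    qed
    also have "\<dots> = e / (I + 1) * I" by (simp add: I_def)
    also have "\<dots> \<le> e" using that I0 by (simp add: field_simps)
    finally show ?thesis .
  qed
  then have "cmod J \<le> 0" by (meson dense_ge)
  then show ?thesis by (simp add: torus_int_def J_def)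
qed

text \<open>The indicator of \<open>K\<close> is a decreasing limit of continuous functions of \<open>torus_embedding\<close>, because
  the embedding is injective on the half-open cube.\<close>

lemma set_integral_compact_zero:
  fixes f :: "real^'n \<Rightarrow> complex"
  assumes f: "set_integrable lebesgue torus_cube f" "\<And>k. fourier_coeff f k = 0"
    and K: "compact K" "K \<subseteq> torus_cube"
  shows "(LINT x:K|lebesgue. f x) = 0"
proof (cases "K = {}")
  case True
  then show ?thesis by (simp add: set_lebesgue_integral_def)
next
  case False
  define C where "C = torus_embedding ` K"
  \<comment> \<open>A tent over \<open>C\<close>: it equals 1 on \<open>C\<close> and, for m > 0,
    vanishes at distance 1/m and beyond.\<close>
  define F where "F = (\<lambda>m z. max 0 (1 - real m * infdist z C))"
  have C: "closed C" "C \<noteq> {}"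
    using False K by (auto simp: C_def intro!: compact_imp_closed compact_continuous_image continuous_intros)
  have F: "continuous_on UNIV (F m)" for m
    unfolding F_def by (intro continuous_intros)
  have zero: "(\<integral>x. indicator torus_cube x *\<^sub>R (f x * of_real (F m (torus_embedding x))) \<partial>lebesgue) = 0" for m
    using torus_int_continuous_zero[OF f F[of m]] by (simp add: torus_int_def set_lebesgue_integral_def)
  have meas: "(\<lambda>x. indicator torus_cube x *\<^sub>R f x) \<in> borel_measurable lebesgue"
    using f(1) unfolding set_integrable_def by (rule borel_measurable_integrable)
  have "(\<lambda>m. \<integral>x. indicator torus_cube x *\<^sub>R (f x * of_real (F m (torus_embedding x))) \<partial>lebesgue)
      \<longlonglongrightarrow> (\<integral>x. indicator K x *\<^sub>R f x \<partial>lebesgue)"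
  proof (rule integral_dominated_convergence)
    have "K \<in> sets lebesgue" using K(1) by (simp add: borel_compact)
    then have "(\<lambda>x. indicat_real K x *\<^sub>R (indicator torus_cube x *\<^sub>R f x)) \<in> borel_measurable lebesgue"
      by (intro borel_measurable_scaleR[OF borel_measurable_indicator meas])
    moreover have "indicat_real K x *\<^sub>R (indicat_real torus_cube x *\<^sub>R f x) = indicat_real K x *\<^sub>R f x" for x
      using K(2) by (cases "x \<in> K") auto
    ultimately show "(\<lambda>x. indicator K x *\<^sub>R f x) \<in> borel_measurable lebesgue"
      by (simp only:)
    show "(\<lambda>x. indicator torus_cube x *\<^sub>R (f x * of_real (F m (torus_embedding x)))) \<in> borel_measurable lebesgue" for m
    proof -
      have "(\<lambda>x. complex_of_real (F m (torus_embedding x))) \<in> borel_measurable lebesgue"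
        by (intro continuous_imp_borel_lebesgue continuous_intros continuous_on_compose2[OF F]) auto
      then have "(\<lambda>x. (indicator torus_cube x *\<^sub>R f x) * complex_of_real (F m (torus_embedding x))) \<in> borel_measurable lebesgue"
        by (intro borel_measurable_times meas)
      then show ?thesis by (simp only: mult_scaleR_left)
    qed
    show "integrable lebesgue (\<lambda>x. cmod (indicator torus_cube x *\<^sub>R f x))"
      using f(1) unfolding set_integrable_def by (rule integrable_norm)
    show "AE x in lebesgue. norm (indicator torus_cube x *\<^sub>R (f x * of_real (F m (torus_embedding x))))
        \<le> cmod (indicator torus_cube x *\<^sub>R f x)" for m
    proof (intro AE_I2)
      fix x :: "real^'n"
      have "\<bar>F m (torus_embedding x)\<bar> \<le> 1" by (auto simp: F_def infdist_nonneg)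
      then have "cmod (f x) * \<bar>F m (torus_embedding x)\<bar> \<le> cmod (f x)" by (intro mult_left_le) auto
      then show "norm (indicator torus_cube x *\<^sub>R (f x * of_real (F m (torus_embedding x))))
        \<le> cmod (indicator torus_cube x *\<^sub>R f x)"
        by (cases "x \<in> torus_cube") (auto simp: norm_mult)
    qed
    show "AE x in lebesgue. (\<lambda>m. indicator torus_cube x *\<^sub>R (f x * of_real (F m (torus_embedding x))))
        \<longlonglongrightarrow> indicator K x *\<^sub>R f x"
    proof (intro AE_I2)
      fix x :: "real^'n"
      consider "x \<notin> torus_cube" | "x \<in> K" | "x \<in> torus_cube" "x \<notin> K" by blast
      then show "(\<lambda>m. indicator torus_cube x *\<^sub>R (f x * of_real (F m (torus_embedding x))))
        \<longlonglongrightarrow> indicator K x *\<^sub>R f x"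
      proof cases
        case 1
        then show ?thesis using K(2) by (auto simp: indicator_def)
      next
        case 2
        then have "torus_embedding x \<in> C" by (simp add: C_def)
        then have "F m (torus_embedding x) = 1" for m by (simp add: F_def)
        then show ?thesis using 2 K(2) by (auto simp: indicator_def)
      next
        case 3
        \<comment> \<open>Injectivity keeps the image of \<open>x\<close> outside \<open>C\<close>.
          As \<open>C\<close> is closed, the distance is positive and the tents vanish there for all
          large m.\<close>
        then have "torus_embedding x \<notin> C"
          using K(2) inj_on_torus_embedding by (auto simp: C_def inj_on_def)
        then have pos: "infdist (torus_embedding x) C > 0"
          using C by (simp add: infdist_pos_not_in_closed)
        then obtain M :: nat where M: "1 < real M * infdist (torus_embedding x) C"
          using reals_Archimedean3 by blast
        have "\<forall>\<^sub>F m in sequentially. F m (torus_embedding x) = 0"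
          using eventually_ge_at_top[of M]
        proof eventually_elim
          case (elim m)
          then have "real M * infdist (torus_embedding x) C \<le> real m * infdist (torus_embedding x) C"
            using pos by (intro mult_right_mono) auto
          with M show ?case by (simp add: F_def)
        qed
        then have "\<forall>\<^sub>F m in sequentially. indicator torus_cube x *\<^sub>R (f x * of_real (F m (torus_embedding x)))
            = indicator K x *\<^sub>R f x"
          by eventually_elim (use 3 in auto)
        then show ?thesis by (rule tendsto_eventually)
      qed
    qed
  qed
  then show ?thesis unfolding zero by (simp add: set_lebesgue_integral_def LIMSEQ_const_iff)
qed

text \<open>Inner regularity: the set where \<open>g\<close> is positive contains a closed set of
  almost the same measure, compact because \<open>A\<close> is bounded. A positive function with
  integral zero on it makes that compact set null, so the whole set has measure below every
  e.\<close>

lemma AE_nonpos_if_compact_integrals_zero: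
  fixes g :: "real^'n \<Rightarrow> real"
  assumes g: "set_integrable lebesgue A g" and A: "bounded A"
    and zero: "\<And>K. compact K \<Longrightarrow> K \<subseteq> A \<Longrightarrow> (LINT x:K|lebesgue. g x) = 0"
  shows "AE x in lebesgue. x \<in> A \<longrightarrow> g x \<le> 0"
proof -
  define S where "S = {x. 0 < indicator A x *\<^sub>R g x}"
  have [measurable]: "(\<lambda>x. indicator A x *\<^sub>R g x) \<in> borel_measurable lebesgue"
    using g unfolding set_integrable_def by (rule borel_measurable_integrable)
  have "{x \<in> space lebesgue. 0 < indicator A x *\<^sub>R g x} \<in> sets lebesgue"
    by measurable
  then have S: "S \<in> sets lebesgue" by (simp add: S_def)
  have SA: "S \<subseteq> A" by (auto simp: S_def indicator_def)
  have "emeasure lebesgue S \<le> 0 + ennreal e" if "e > 0" for e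
  proof -
    obtain K where K: "closed K" "K \<subseteq> S" "S - K \<in> lmeasurable" "emeasure lebesgue (S - K) < ennreal e"
      using sets_lebesgue_inner_closed[OF S \<open>e > 0\<close>] .
    then have "compact K" using A SA by (meson bounded_subset compact_eq_bounded_closed)
    have KA: "K \<subseteq> A" using K SA by auto
    have Kl: "K \<in> sets lebesgue" using K(1) by simp
    have "set_integrable lebesgue K g"
      using set_integrable_subset[OF g Kl KA] .
    then have int: "integrable lebesgue (\<lambda>x. indicator K x *\<^sub>R g x)" by (simp add: set_integrable_def)
    have pos: "0 < g x" if "x \<in> K" for x
    proof -
      have "x \<in> A" "x \<in> S" using that KA K(2) by auto
      then show ?thesis by (simp add: S_def)
    qed
    have nonneg: "0 \<le> indicator K x *\<^sub>R g x" for x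
      using pos[of x] by (cases "x \<in> K") auto
    have "(\<integral>x. indicator K x *\<^sub>R g x \<partial>lebesgue) = 0"
      using zero[OF \<open>compact K\<close> KA] by (simp add: set_lebesgue_integral_def)
    then have "AE x in lebesgue. indicator K x *\<^sub>R g x = 0"
      using integral_nonneg_eq_0_iff_AE[OF int] nonneg by simp
    then have "AE x in lebesgue. x \<notin> K"
    proof eventually_elim
      case (elim x)
      then show ?case using pos[of x] by (auto simp: indicator_def)
    qed
    then have "emeasure lebesgue K = 0"
      using AE_iff_measurable[OF Kl, of "\<lambda>x. x \<notin> K"] by simp
    moreover have "emeasure lebesgue S = emeasure lebesgue K + emeasure lebesgue (S - K)"
      using plus_emeasure[of K lebesgue "S - K"] K(2) Kl S by (simp add: Un_absorb1)
    ultimately show ?thesis using K(4) by simp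
  qed
  then have "emeasure lebesgue S \<le> 0"
    by (rule ennreal_le_epsilon)
  then have "S \<in> null_sets lebesgue" using S by (simp add: null_sets_def)
  then have "AE x in lebesgue. x \<notin> S" by (rule AE_not_in)
  then show ?thesis by eventually_elim (auto simp: S_def indicator_def)
qed

theorem fourier_coeff_zero_imp_AE_zero:
  fixes f :: "real^'n \<Rightarrow> complex"
  assumes f: "set_integrable lebesgue torus_cube f" "\<And>k. fourier_coeff f k = 0"
  shows "AE x in lebesgue. x \<in> torus_cube \<longrightarrow> f x = 0"
proof -
  have int: "integrable lebesgue (\<lambda>x. indicator torus_cube x *\<^sub>R f x)"
    using f(1) by (simp add: set_integrable_def)
  \<comment> \<open>The complex equation is split into four real inequalities, with \<open>L\<close>
    one of Re, -Re, Im, -Im.\<close>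
  have part: "AE x in lebesgue. x \<in> torus_cube \<longrightarrow> L (f x) \<le> 0" if L: "bounded_linear L" for L :: "complex \<Rightarrow> real"
  proof (rule AE_nonpos_if_compact_integrals_zero[OF _ bounded_torus_cube])
    interpret L: bounded_linear L by fact
    show "set_integrable lebesgue torus_cube (\<lambda>x. L (f x))"
      using integrable_bounded_linear[OF L int] by (simp add: set_integrable_def L.scaleR)
    fix K :: "(real^'n) set" assume K: "compact K" "K \<subseteq> torus_cube"
    have "K \<in> sets lebesgue" using K(1) by (simp add: borel_compact)
    then have "integrable lebesgue (\<lambda>x. indicator K x *\<^sub>R f x)"
      using set_integrable_subset[OF f(1) _ K(2)] by (simp add: set_integrable_def)
    from integral_bounded_linear[OF L this]
    show "(LINT x:K|lebesgue. L (f x)) = 0"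
      using set_integral_compact_zero[OF f K] by (simp add: set_lebesgue_integral_def L.scaleR L.zero)
  qed
  show ?thesis
    using part[OF bounded_linear_Re] part[OF bounded_linear_minus[OF bounded_linear_Re]]
      part[OF bounded_linear_Im] part[OF bounded_linear_minus[OF bounded_linear_Im]]
    by eventually_elim (auto simp: complex_eq_iff)
qed

section \<open>Sup norm, Wiener norm and weighted norm\<close>

lemma fourier_coeff_lincomb:
  assumes "set_integrable lebesgue torus_cube f" "set_integrable lebesgue torus_cube g"
  shows "fourier_coeff (\<lambda>x. a * f x + b * g x) k = a * fourier_coeff f k + b * fourier_coeff g k"
proof -
  have "fourier_coeff (\<lambda>x. a * f x + b * g x) k
      = torus_int (\<lambda>x. a * (f x * fourier_char (- k) x) + b * (g x * fourier_char (- k) x))"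
    unfolding fourier_coeff_eq by (simp add: algebra_simps)
  also have "\<dots> = torus_int (\<lambda>x. a * (f x * fourier_char (- k) x)) + torus_int (\<lambda>x. b * (g x * fourier_char (- k) x))"
    by (intro torus_int_add set_integrable_mult_right set_integrable_mult_fourier_char assms)
  finally show ?thesis by (simp only: torus_int_mult_right fourier_coeff_eq)
qed

lemma fourier_coeff_diff:
  assumes "set_integrable lebesgue torus_cube f" "set_integrable lebesgue torus_cube g"
  shows "fourier_coeff (\<lambda>x. f x - g x) k = fourier_coeff f k - fourier_coeff g k"
  using fourier_coeff_lincomb[OF assms, of 1 "-1"] by simp

lemma L1_torus_lincomb:
  assumes "f \<in> L1_torus" "g \<in> L1_torus"
  shows "(\<lambda>x. a * f x + b * g x) \<in> L1_torus"
  using assms by (auto simp: L1_torus_def torus_periodic_def intro!: set_integral_add)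

lemma L1_torus_diff: "f \<in> L1_torus \<Longrightarrow> g \<in> L1_torus \<Longrightarrow> (\<lambda>x. f x - g x) \<in> L1_torus"
  using L1_torus_lincomb[of f g 1 "-1"] by simp

lemma norm_fourier_coeff_le:
  assumes "set_integrable lebesgue torus_cube f"
    and "AE x in lebesgue. x \<in> torus_cube \<longrightarrow> cmod (f x) \<le> M"
  shows "cmod (fourier_coeff f k) \<le> M"
  unfolding fourier_coeff_eq using assms
  by (intro norm_torus_int_le set_integrable_mult_fourier_char) (auto simp: norm_mult)

section \<open>Finite character sums\<close>

abbreviation char_sum :: "(int^'n) set \<Rightarrow> (int^'n \<Rightarrow> complex) \<Rightarrow> real^'n \<Rightarrow> complex" where
  "char_sum K c \<equiv> (\<lambda>x. \<Sum>k\<in>K. c k * fourier_char k x)"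

lemma trig_poly_char_sum: "trig_poly (char_sum K c)"
  by (intro trig_poly_sum trig_poly.intros)

lemma trig_poly_set_integrable:
  fixes p :: "real^'n \<Rightarrow> complex"
  assumes "trig_poly p"
  shows "set_integrable lebesgue torus_cube p"
  using set_integrable_torus_bounded trig_poly_bounded[OF assms]
    continuous_imp_borel_lebesgue[OF trig_poly_continuous[OF assms]] by blast

lemma trig_poly_L1: "trig_poly p \<Longrightarrow> p \<in> L1_torus"
  by (simp add: L1_torus_def trig_poly_periodic trig_poly_set_integrable)

lemma fourier_coeff_char_sum:
  assumes "finite K"
  shows "fourier_coeff (char_sum K c) k = (if k \<in> K then c k else 0)"
proof -
  have "fourier_coeff (char_sum K c) k = torus_int (\<lambda>x. \<Sum>j\<in>K. c j * fourier_char (j - k) x)"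
    by (simp add: fourier_coeff_eq sum_distrib_right mult.assoc fourier_char_mult)
  also have "\<dots> = (\<Sum>j\<in>K. torus_int (\<lambda>x. c j * fourier_char (j - k) x))"
    by (intro torus_int_sum trig_poly_set_integrable trig_poly.intros)
  also have "\<dots> = (\<Sum>j\<in>K. if j = k then c j else 0)"
    by (intro sum.cong refl) (simp add: torus_int_mult_right torus_int_fourier_char)
  finally show ?thesis using assms by simp
qed

text \<open>Only the conjugate factor of the squared modulus is expanded; the integrals that remain
  are Fourier coefficients of the sum itself, which are already known.\<close>

lemma char_sum_parseval:
  assumes "finite K"
  shows "torus_int (\<lambda>x. of_real ((cmod (char_sum K c x))\<^sup>2)) = of_real (\<Sum>k\<in>K. (cmod (c k))\<^sup>2)"
proof -
  have "of_real ((cmod (char_sum K c x))\<^sup>2) = (\<Sum>k\<in>K. cnj (c k) * (char_sum K c x * fourier_char (- k) x))" for x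
    by (simp add: complex_norm_square sum_distrib_left cnj_fourier_char mult_ac del: of_real_power)
  then have "torus_int (\<lambda>x. of_real ((cmod (char_sum K c x))\<^sup>2))
      = (\<Sum>k\<in>K. torus_int (\<lambda>x. cnj (c k) * (char_sum K c x * fourier_char (- k) x)))"
    by (simp only:) (intro torus_int_sum trig_poly_set_integrable trig_poly.scale trig_poly_mult
        trig_poly_char_sum trig_poly.char)
  also have "\<dots> = (\<Sum>k\<in>K. cnj (c k) * fourier_coeff (char_sum K c) k)"
    by (simp only: torus_int_mult_right fourier_coeff_eq)
  also have "\<dots> = of_real (\<Sum>k\<in>K. (cmod (c k))\<^sup>2)"
    using assms by (simp add: fourier_coeff_char_sum complex_norm_square mult.commute del: of_real_power)
  finally show ?thesis .
qed

section \<open>The essential supremum norm\<close>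

lemma Linf_norm_le:
  assumes "0 \<le> C" "AE x in lebesgue. x \<in> torus_cube \<longrightarrow> cmod (f x) \<le> C"
  shows "Linf_norm f \<le> C"
  unfolding Linf_norm_def using assms by (intro cInf_lower bdd_belowI[of _ 0]) auto

text \<open>The infimum is itself an essential bound: \<open>Linf_norm f + 1 / real (Suc m)\<close>
  is one for every m, and the countably many exceptional null sets have a null union.\<close>

lemma
  assumes "f \<in> Linf_space"
  shows Linf_norm_nonneg: "0 \<le> Linf_norm f"
    and AE_le_Linf_norm: "AE x in lebesgue. x \<in> torus_cube \<longrightarrow> cmod (f x) \<le> Linf_norm f"
proof -
  let ?A = "{C. 0 \<le> C \<and> (AE x in lebesgue. x \<in> torus_cube \<longrightarrow> cmod (f x) \<le> C)}"
  obtain C where "AE x in lebesgue. x \<in> torus_cube \<longrightarrow> cmod (f x) \<le> C"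
    using assms by (auto simp: Linf_space_def)
  then have "AE x in lebesgue. x \<in> torus_cube \<longrightarrow> cmod (f x) \<le> \<bar>C\<bar>"
    by eventually_elim (meson abs_ge_self order_trans)
  then have "\<bar>C\<bar> \<in> ?A" by simp
  then have ne: "?A \<noteq> {}" by blast
  then show "0 \<le> Linf_norm f" unfolding Linf_norm_def by (rule cInf_greatest) auto
  have "AE x in lebesgue. x \<in> torus_cube \<longrightarrow> cmod (f x) \<le> Linf_norm f + 1 / real (Suc m)" for m
  proof -
    have "Linf_norm f < Linf_norm f + 1 / real (Suc m)" by simp
    then obtain D where D: "D \<in> ?A" "D < Linf_norm f + 1 / real (Suc m)"
      unfolding Linf_norm_def using cInf_lessD[OF ne] by blast
    then have "AE x in lebesgue. x \<in> torus_cube \<longrightarrow> cmod (f x) \<le> D" by blast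
    then show ?thesis by eventually_elim (use D(2) in auto)
  qed
  then have "AE x in lebesgue. \<forall>m. x \<in> torus_cube \<longrightarrow> cmod (f x) \<le> Linf_norm f + 1 / real (Suc m)"
    by (intro AE_all_countable[THEN iffD2] allI)
  then show "AE x in lebesgue. x \<in> torus_cube \<longrightarrow> cmod (f x) \<le> Linf_norm f"
  proof eventually_elim
    case (elim x)
    show ?case
    proof
      assume "x \<in> torus_cube"
      then have *: "cmod (f x) \<le> Linf_norm f + 1 / real (Suc m)" for m using elim by blast
      have "(\<lambda>m. Linf_norm f + 1 / real (Suc m)) \<longlonglongrightarrow> Linf_norm f + 0"
        using LIMSEQ_inverse_real_of_nat by (intro tendsto_intros) (simp add: inverse_eq_divide)
      then show "cmod (f x) \<le> Linf_norm f"
        using LIMSEQ_le_const[of _ "Linf_norm f + 0" "cmod (f x)"] * by auto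
    qed
  qed
qed

lemma Linf_norm_diff_le:
  assumes "f \<in> Linf_space" "g \<in> Linf_space"
  shows "Linf_norm (\<lambda>x. f x - g x) \<le> Linf_norm f + Linf_norm g"
proof (rule Linf_norm_le)
  show "0 \<le> Linf_norm f + Linf_norm g" using assms by (simp add: Linf_norm_nonneg)
  show "AE x in lebesgue. x \<in> torus_cube \<longrightarrow> cmod (f x - g x) \<le> Linf_norm f + Linf_norm g"
    using AE_le_Linf_norm[OF assms(1)] AE_le_Linf_norm[OF assms(2)]
    by eventually_elim (meson add_mono norm_triangle_ineq4 order_trans)
qed

lemma trig_poly_Linf:
  fixes p :: "real^'n \<Rightarrow> complex"
  assumes "trig_poly p"
  shows "p \<in> Linf_space"
proof -
  have "set_borel_measurable lebesgue torus_cube p"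
    using borel_measurable_integrable trig_poly_set_integrable[OF assms]
    unfolding set_integrable_def set_borel_measurable_def by blast
  then show ?thesis
    using trig_poly_bounded[OF assms] trig_poly_periodic[OF assms]
    unfolding Linf_space_def by auto
qed

lemma trig_poly_C_space: "trig_poly p \<Longrightarrow> p \<in> C_space"
  unfolding C_space_def using trig_poly_Linf trig_poly_continuous trig_poly_periodic by auto

text \<open>The Fourier series converges uniformly by the Weierstrass M-test. Its sum
  \<open>g\<close> is continuous, bounded by the Wiener norm everywhere, and has the coefficients of
  \<open>f\<close>, so uniqueness gives \<open>f = g\<close> almost everywhere.\<close>

lemma AE_le_Wiener_norm:
  fixes f :: "real^'n \<Rightarrow> complex"
  assumes "f \<in> Wiener_space"
  shows "AE x in lebesgue. x \<in> torus_cube \<longrightarrow> cmod (f x) \<le> Wiener_norm f"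
proof -
  have f: "set_integrable lebesgue torus_cube f" and
    sum: "(\<lambda>k. cmod (fourier_coeff f k)) summable_on UNIV"
    using assms by (auto simp: Wiener_space_def L1_torus_def)
  define S where "S = (\<lambda>K. char_sum K (fourier_coeff f))"
  define g where "g = (\<lambda>x. \<Sum>\<^sub>\<infinity>k. fourier_coeff f k * fourier_char k x)"
  have lim: "uniform_limit UNIV S g (finite_subsets_at_top UNIV)"
    unfolding S_def g_def
    by (intro Weierstrass_m_test_general[OF _ sum]) (simp add: norm_mult)
  have "continuous_on UNIV g"
    by (rule uniform_limit_theorem[OF _ lim])
       (auto simp: S_def intro!: always_eventually trig_poly_continuous trig_poly_char_sum)
  then have g_meas: "g \<in> borel_measurable lebesgue" by (rule continuous_imp_borel_lebesgue)
  have g_le: "cmod (g x) \<le> Wiener_norm f" for x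
    unfolding g_def Wiener_norm_def
  proof (rule norm_infsum_le)
    show "((\<lambda>k. fourier_coeff f k * fourier_char k x) has_sum (\<Sum>\<^sub>\<infinity>k. fourier_coeff f k * fourier_char k x)) UNIV"
      by (rule has_sum_infsum, rule abs_summable_summable) (simp add: norm_mult sum)
    show "((\<lambda>k. cmod (fourier_coeff f k)) has_sum (\<Sum>\<^sub>\<infinity>k. cmod (fourier_coeff f k))) UNIV"
      using sum by (rule has_sum_infsum)
  qed (simp add: norm_mult)
  have g: "set_integrable lebesgue torus_cube g"
    using set_integrable_torus_bounded[OF g_meas] g_le by blast
  have "fourier_coeff g k = fourier_coeff f k" for k
  proof -
    have "cmod (fourier_coeff g k - fourier_coeff f k) \<le> e" if "e > 0" for e
    proof -
      have "\<forall>\<^sub>F K in finite_subsets_at_top UNIV. \<forall>x\<in>UNIV. dist (S K x) (g x) < e"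
        using lim that by (rule uniform_limitD)
      \<comment> \<open>Convergence is along finite sets of frequencies, so the set may be assumed
        to contain \<open>k\<close>; the coefficient of \<open>S K\<close> at \<open>k\<close> is
        then exactly that of \<open>f\<close>.\<close>
      moreover have "\<forall>\<^sub>F K in finite_subsets_at_top UNIV. finite K \<and> {k} \<subseteq> K \<and> K \<subseteq> UNIV"
        unfolding eventually_finite_subsets_at_top by (intro exI[of _ "{k}"]) auto
      ultimately have "\<forall>\<^sub>F K in finite_subsets_at_top UNIV. (\<forall>x\<in>UNIV. dist (S K x) (g x) < e) \<and> finite K \<and> {k} \<subseteq> K"
        by eventually_elim auto
      from eventually_happens'[OF finite_subsets_at_top_neq_bot this]
      obtain K where K: "\<And>x. dist (S K x) (g x) < e" "finite K" "k \<in> K"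
        by auto
      have S: "set_integrable lebesgue torus_cube (S K)"
        unfolding S_def by (intro trig_poly_set_integrable trig_poly_char_sum)
      have "cmod (fourier_coeff (\<lambda>x. g x - S K x) k) \<le> e"
        using K(1) by (intro norm_fourier_coeff_le set_integral_diff g S)
          (auto simp: dist_norm norm_minus_commute less_imp_le)
      moreover have "fourier_coeff (S K) k = fourier_coeff f k"
        using K by (simp add: S_def fourier_coeff_char_sum)
      ultimately show ?thesis by (simp add: fourier_coeff_diff g S)
    qed
    then have "cmod (fourier_coeff g k - fourier_coeff f k) \<le> 0" by (meson dense_ge)
    then show ?thesis by simp
  qed
  then have "AE x in lebesgue. x \<in> torus_cube \<longrightarrow> f x - g x = 0"
    by (intro fourier_coeff_zero_imp_AE_zero set_integral_diff f g) (simp add: fourier_coeff_diff f g)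
  then show ?thesis
    by eventually_elim (use g_le in auto)
qed

lemma Wiener_norm_nonneg: "0 \<le> Wiener_norm f"
  by (simp add: Wiener_norm_def infsum_nonneg)

lemma Linf_norm_le_Wiener_norm: "f \<in> Wiener_space \<Longrightarrow> Linf_norm f \<le> Wiener_norm f"
  by (intro Linf_norm_le Wiener_norm_nonneg AE_le_Wiener_norm)

lemma Wiener_space_subset_Linf_space: "Wiener_space \<subseteq> Linf_space"
proof
  fix f :: "real^'n \<Rightarrow> complex" assume f: "f \<in> Wiener_space"
  then have "set_borel_measurable lebesgue torus_cube f"
    unfolding set_borel_measurable_def Wiener_space_def L1_torus_def set_integrable_def
    using borel_measurable_integrable by blast
  then show "f \<in> Linf_space"
    using f AE_le_Wiener_norm[OF f] unfolding Linf_space_def Wiener_space_def L1_torus_def by blast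
qed

lemma Wiener_norm_diff_le:
  assumes "f \<in> Wiener_space" "g \<in> Wiener_space"
  shows "Wiener_norm (\<lambda>x. f x - g x) \<le> Wiener_norm f + Wiener_norm g"
proof -
  have fg: "f \<in> L1_torus" "g \<in> L1_torus" and
    sf: "(\<lambda>k. cmod (fourier_coeff f k)) summable_on UNIV" and
    sg: "(\<lambda>k. cmod (fourier_coeff g k)) summable_on UNIV"
    using assms by (auto simp: Wiener_space_def)
  then have coeff: "fourier_coeff (\<lambda>x. f x - g x) k = fourier_coeff f k - fourier_coeff g k" for k
    by (intro fourier_coeff_diff) (auto simp: L1_torus_def)
  have s: "(\<lambda>k. cmod (fourier_coeff f k) + cmod (fourier_coeff g k)) summable_on UNIV"
    using sf sg by (rule summable_on_add)
  have s': "(\<lambda>k. cmod (fourier_coeff (\<lambda>x. f x - g x) k)) summable_on UNIV"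
    by (rule summable_on_comparison_test[OF s]) (auto simp: coeff norm_triangle_ineq4)
  have "Wiener_norm (\<lambda>x. f x - g x) \<le> (\<Sum>\<^sub>\<infinity>k. cmod (fourier_coeff f k) + cmod (fourier_coeff g k))"
    unfolding Wiener_norm_def using s' s by (rule infsum_mono) (auto simp: coeff norm_triangle_ineq4)
  also have "\<dots> = Wiener_norm f + Wiener_norm g"
    unfolding Wiener_norm_def using sf sg by (rule infsum_add)
  finally show "Wiener_norm (\<lambda>x. f x - g x) \<le> Wiener_norm f + Wiener_norm g" .
qed

lemma char_sum_Wiener:
  assumes "finite K"
  shows "char_sum K c \<in> Wiener_space"
proof -
  have "(\<lambda>k. cmod (fourier_coeff (char_sum K c) k)) summable_on UNIV \<longleftrightarrow>
      (\<lambda>k. cmod (c k)) summable_on K"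
    using assms by (intro summable_on_cong_neutral) (auto simp: fourier_coeff_char_sum)
  then show ?thesis
    using assms by (simp add: Wiener_space_def trig_poly_L1 trig_poly_char_sum)
qed

lemma
  assumes "finite K"
  shows char_sum_F_space: "char_sum K c \<in> F_space w"
    and F_norm_char_sum: "F_norm w (char_sum K c) = sqrt (\<Sum>k\<in>K. (w k * cmod (c k))\<^sup>2)"
proof -
  let ?h = "\<lambda>k. (w k)\<^sup>2 * (cmod (fourier_coeff (char_sum K c) k))\<^sup>2"
  have "?h summable_on UNIV \<longleftrightarrow> (\<lambda>k. (w k * cmod (c k))\<^sup>2) summable_on K"
    using assms by (intro summable_on_cong_neutral) (auto simp: fourier_coeff_char_sum power_mult_distrib)
  then show "char_sum K c \<in> F_space w"
    using assms by (simp add: F_space_def trig_poly_L1 trig_poly_char_sum)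
  have "infsum ?h UNIV = infsum (\<lambda>k. (w k * cmod (c k))\<^sup>2) K"
    using assms by (intro infsum_cong_neutral) (auto simp: fourier_coeff_char_sum power_mult_distrib)
  then show "F_norm w (char_sum K c) = sqrt (\<Sum>k\<in>K. (w k * cmod (c k))\<^sup>2)"
    using assms by (simp add: F_norm_def)
qed

lemma F_norm_nonneg: "0 \<le> F_norm w f"
  by (simp add: F_norm_def infsum_nonneg)

text \<open>Cauchy-Schwarz applied to \<open>1 / w k\<close> and
  \<open>w k * cmod (fourier_coeff f k)\<close>. The set \<open>S\<close> is left free for three
  uses: all frequencies for the embedding, a finite set for the boundedness of the truncation, and
  its complement for the truncation error.\<close>

lemma
  assumes f: "f \<in> F_space w" and w: "\<And>k. w k > 0"
    and sum: "(\<lambda>k. 1 / (w k)\<^sup>2) summable_on S"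
  shows F_space_coeff_summable: "(\<lambda>k. cmod (fourier_coeff f k)) summable_on S"
    and F_space_coeff_sum_le: "(\<Sum>\<^sub>\<infinity>k\<in>S. cmod (fourier_coeff f k)) \<le> sqrt (\<Sum>\<^sub>\<infinity>k\<in>S. 1 / (w k)\<^sup>2) * F_norm w f"
proof -
  have fsum: "(\<lambda>k. (w k)\<^sup>2 * (cmod (fourier_coeff f k))\<^sup>2) summable_on UNIV"
    using f by (simp add: F_space_def)
  have bound: "(\<Sum>k\<in>K. cmod (fourier_coeff f k)) \<le> sqrt (\<Sum>\<^sub>\<infinity>k\<in>S. 1 / (w k)\<^sup>2) * F_norm w f"
    if K: "finite K" "K \<subseteq> S" for K
  proof -
    have "(\<Sum>k\<in>K. cmod (fourier_coeff f k)) = (\<Sum>k\<in>K. \<bar>1 / w k\<bar> * \<bar>w k * cmod (fourier_coeff f k)\<bar>)"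
      using w by (intro sum.cong refl) (simp add: abs_mult order_less_imp_not_eq2)
    also have "\<dots> \<le> L2_set (\<lambda>k. 1 / w k) K * L2_set (\<lambda>k. w k * cmod (fourier_coeff f k)) K"
      by (rule L2_set_mult_ineq)
    also have "\<dots> \<le> sqrt (\<Sum>\<^sub>\<infinity>k\<in>S. 1 / (w k)\<^sup>2) * F_norm w f"
    proof (rule mult_mono)
      show "L2_set (\<lambda>k. 1 / w k) K \<le> sqrt (\<Sum>\<^sub>\<infinity>k\<in>S. 1 / (w k)\<^sup>2)"
        unfolding L2_set_def power_one_over using sum K
        by (intro real_sqrt_le_mono finite_sum_le_infsum) auto
      show "L2_set (\<lambda>k. w k * cmod (fourier_coeff f k)) K \<le> F_norm w f"
        unfolding L2_set_def F_norm_def power_mult_distrib using fsum K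
        by (intro real_sqrt_le_mono finite_sum_le_infsum) auto
    qed (auto simp: infsum_nonneg)
    finally show ?thesis .
  qed
  show *: "(\<lambda>k. cmod (fourier_coeff f k)) summable_on S"
    using bound by (intro nonneg_bdd_above_summable_on bdd_aboveI2) auto
  show "(\<Sum>\<^sub>\<infinity>k\<in>S. cmod (fourier_coeff f k)) \<le> sqrt (\<Sum>\<^sub>\<infinity>k\<in>S. 1 / (w k)\<^sup>2) * F_norm w f"
    using bound by (intro infsum_le_finite_sums[OF *]) auto
qed

section \<open>Lower bound\<close>

text \<open>The points of \<open>U\<close> violating the bound form an open set by continuity, and a
  nonempty open set is not null.\<close>

lemma AE_le_imp_le_on_open:
  fixes p :: "'a::euclidean_space \<Rightarrow> complex"
  assumes p: "continuous_on UNIV p" and U: "open U"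
    and ae: "AE x in lebesgue. x \<in> U \<longrightarrow> cmod (p x) \<le> e" and x: "x \<in> U"
  shows "cmod (p x) \<le> e"
proof (rule ccontr)
  assume "\<not> cmod (p x) \<le> e"
  define V where "V = U \<inter> {x. e < cmod (p x)}"
  have V: "open V" unfolding V_def
    by (intro open_Int U open_Collect_less continuous_intros p)
  have "AE x in lebesgue. x \<notin> V" using ae by eventually_elim (auto simp: V_def)
  then have "V \<in> null_sets lebesgue"
    using V by (subst AE_iff_null_sets) auto
  then have "negligible V" by (simp add: negligible_iff_null_sets)
  moreover have "x \<in> V" using x \<open>\<not> cmod (p x) \<le> e\<close> by (simp add: V_def)
  ultimately show False using open_not_negligible[OF V] by blast
qed

text \<open>Links the pointwise bounds, available on the open box, with integrals over the half-open
  cube.\<close>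

lemma AE_torus_cube_interior:
  "AE x in lebesgue. x \<in> torus_cube \<longrightarrow> x \<in> box (0 :: real^'n) (\<chi> i. 2 * pi)"
proof -
  have "negligible (cbox (0 :: real^'n) (\<chi> i. 2 * pi) - box 0 (\<chi> i. 2 * pi))"
    by (rule negligible_frontier_interval)
  then have "AE x in lebesgue. x \<notin> cbox (0 :: real^'n) (\<chi> i. 2 * pi) - box 0 (\<chi> i. 2 * pi)"
    by (intro AE_not_in) (simp add: negligible_iff_null_sets)
  then show ?thesis
    by eventually_elim (auto simp: torus_cube_def mem_box_cart less_imp_le)
qed

lemma fourier_char_F_space: "fourier_char k \<in> F_space w"
  using char_sum_F_space[of "{k}" "\<lambda>_. 1" w] by simp

lemma lin_on_char_sum:
  assumes lin: "lin_on (F_space w) A" and K: "finite K"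
  shows "A (char_sum K v) = (\<lambda>x. \<Sum>k\<in>K. v k * A (fourier_char k) x)"
  using K
proof (induction K rule: finite_induct)
  case empty
  \<comment> \<open>\<open>lin_on\<close> speaks of two-term combinations only, so the empty sum is
    written as one with zero coefficients.\<close>
  have "A (\<lambda>x. 0 * fourier_char 0 x + 0 * fourier_char 0 x) =
      (\<lambda>x. 0 * A (fourier_char 0) x + 0 * A (fourier_char 0) x)"
    using lin fourier_char_F_space unfolding lin_on_def by blast
  then show ?case by simp
next
  case (insert k K)
  have "A (\<lambda>x. v k * fourier_char k x + 1 * char_sum K v x) =
      (\<lambda>x. v k * A (fourier_char k) x + 1 * A (char_sum K v) x)"
    by (rule lin[unfolded lin_on_def, rule_format, OF fourier_char_F_space char_sum_F_space[OF insert.hyps(1)]])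
  then show ?case using insert by simp
qed

text \<open>The lower bound for finitely many frequencies. The error enters only through functions
  that \<open>A\<close> maps to zero, where it is the essential supremum that counts; this makes the
  statement independent of the target norm.\<close>

lemma annihilated_tail_bound:
  fixes w :: "int^'n \<Rightarrow> real" and \<sigma> :: "nat \<Rightarrow> real" and \<pi> :: "nat \<Rightarrow> int^'n"
  assumes w_pos: "\<And>k. w k > 0"
    and \<pi>_inj: "inj_on \<pi> {1..}"
    and \<sigma>_def: "\<And>j. j \<ge> 1 \<Longrightarrow> \<sigma> j = 1 / w (\<pi> j)"
    and \<sigma>_mono: "\<And>i j. 1 \<le> i \<Longrightarrow> i \<le> j \<Longrightarrow> \<sigma> j \<le> \<sigma> i"
    and n: "1 \<le> n" "n \<le> N"
    and lin: "lin_on (F_space w) A" and rank: "rank_less (F_space w) A n"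
    and bound: "\<And>f. f \<in> F_space w \<Longrightarrow> F_norm w f \<le> 1 \<Longrightarrow> A f = (\<lambda>x. 0) \<Longrightarrow> Linf_norm f \<le> e"
  shows "(\<Sum>j=n..N. (\<sigma> j)\<^sup>2) \<le> e\<^sup>2"
proof -
  define K where "K = \<pi> ` {1..N}"
  define m where "m = Suc N - n"
  have inj: "inj_on \<pi> {1..N}" using \<pi>_inj by (rule inj_on_subset) auto
  have K: "finite K" "card K = N" using inj by (auto simp: K_def card_image)
  have sum_K: "sum h K = (\<Sum>j=1..N. h (\<pi> j))" for h :: "int^'n \<Rightarrow> real"
    unfolding K_def using inj by (simp add: sum.reindex)
  obtain B where B: "finite B" "card B < n"
    and "\<And>f. f \<in> F_space w \<Longrightarrow> \<exists>c. A f = (\<lambda>x. \<Sum>g\<in>B. c g * g x)"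
    using rank unfolding rank_less_def by blast
  \<comment> \<open>The coefficients supplied by \<open>rank_less\<close> need not depend linearly
    on the function. They are fixed on the characters alone, and linearity of \<open>A\<close>
    carries them to character sums.\<close>
  then have "\<forall>k. \<exists>c. A (fourier_char k) = (\<lambda>x. \<Sum>g\<in>B. c g * g x)"
    using fourier_char_F_space by blast
  then obtain c where c: "\<And>k. A (fourier_char k) = (\<lambda>x. \<Sum>g\<in>B. c k g * g x)" by metis
  have "card B + m \<le> card K" using B n by (simp add: m_def K)
  then obtain u where u: "orthonormal_on K m u"
    and sol: "\<And>l g. l < m \<Longrightarrow> g \<in> B \<Longrightarrow> (\<Sum>k\<in>K. c k g / of_real (w k) * u l k) = 0"
    using orthonormal_solutions_exist[of B K m "\<lambda>g k. c k g / of_real (w k)"] B K by blast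
  define F where "F = (\<lambda>a. char_sum K (\<lambda>k. (\<Sum>l<m. a l * u l k) / of_real (w k)))"
  define f where "f = (\<lambda>l. char_sum K (\<lambda>k. u l k / of_real (w k)))"
  have F_f: "F a x = (\<Sum>l<m. a l * f l x)" for a x
    unfolding F_def f_def
    by (simp add: sum_distrib_left sum_distrib_right sum_divide_distrib mult.assoc, rule sum.swap)
  have F_zero: "A (F a) = (\<lambda>x. 0)" for a
  proof
    fix x
    have "A (F a) x = (\<Sum>k\<in>K. (\<Sum>l<m. a l * u l k) / of_real (w k) * (\<Sum>g\<in>B. c k g * g x))"
      unfolding F_def by (subst lin_on_char_sum[OF lin K(1)]) (simp add: c)
    also have "\<dots> = (\<Sum>k\<in>K. \<Sum>l<m. \<Sum>g\<in>B. a l * g x * (c k g / of_real (w k) * u l k))"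
      by (simp add: sum_distrib_left sum_distrib_right sum_divide_distrib mult_ac)
    also have "\<dots> = (\<Sum>l<m. \<Sum>g\<in>B. a l * g x * (\<Sum>k\<in>K. c k g / of_real (w k) * u l k))"
      by (subst sum.swap, intro sum.cong refl, subst sum.swap) (simp add: sum_distrib_left)
    also have "\<dots> = 0" using sol by (intro sum.neutral ballI) simp
    finally show "A (F a) x = 0" .
  qed
  have F_norm: "F_norm w (F a) = sqrt (\<Sum>l<m. (cmod (a l))\<^sup>2)" for a
  proof -
    have "w k * cmod ((\<Sum>l<m. a l * u l k) / of_real (w k)) = cmod (\<Sum>l<m. a l * u l k)" for k
      using w_pos[of k] by (simp add: norm_divide)
    then show ?thesis
      unfolding F_def F_norm_char_sum[OF K(1)] by (simp add: orthonormal_on_norm_sum[OF u])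
  qed
  have F_le: "cmod (F a x) \<le> e"
    if "(\<Sum>l<m. (cmod (a l))\<^sup>2) \<le> 1" "x \<in> box 0 (\<chi> i. 2 * pi)" for a x
  proof -
    have tp: "trig_poly (F a)" unfolding F_def by (rule trig_poly_char_sum)
    have "F a \<in> F_space w" unfolding F_def using K(1) by (rule char_sum_F_space)
    then have "Linf_norm (F a) \<le> e"
      using that(1) by (intro bound F_zero) (simp_all add: F_norm)
    have "AE x in lebesgue. x \<in> box 0 (\<chi> i. 2 * pi) \<longrightarrow> cmod (F a x) \<le> e"
      using AE_le_Linf_norm[OF trig_poly_Linf[OF tp]]
    proof eventually_elim
      case (elim x)
      then show ?case using \<open>Linf_norm (F a) \<le> e\<close>
        by (auto simp: torus_cube_def mem_box_cart less_imp_le)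
    qed
    from AE_le_imp_le_on_open[OF trig_poly_continuous[OF tp] open_box this that(2)] show ?thesis .
  qed
  have square_le: "(\<Sum>l<m. (cmod (f l x))\<^sup>2) \<le> e\<^sup>2" if x: "x \<in> box 0 (\<chi> i. 2 * pi)" for x
  proof -
    define t where "t = sqrt (\<Sum>l<m. (cmod (f l x))\<^sup>2)"
    have t2: "t\<^sup>2 = (\<Sum>l<m. (cmod (f l x))\<^sup>2)" by (simp add: t_def sum_nonneg)
    show ?thesis
    proof (cases "t = 0")
      case True
      then show ?thesis using t2 by simp
    next
      case False
      have "t > 0" using False by (simp add: t_def sum_nonneg less_le)
      \<comment> \<open>The equality case of Cauchy-Schwarz at this particular \<open>x\<close>:
        these unit coefficients make \<open>F a x\<close> equal to \<open>t\<close>.\<close>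
      define a where "a = (\<lambda>l. cnj (f l x) / of_real t)"
      have "(\<Sum>l<m. (cmod (a l))\<^sup>2) = 1"
        using \<open>t > 0\<close> by (simp add: a_def norm_divide power_divide sum_divide_distrib[symmetric] flip: t2)
      then have "cmod (F a x) \<le> e" using x by (intro F_le) auto
      moreover have "F a x = of_real t"
      proof -
        have "F a x = of_real (t\<^sup>2) / of_real t"
          unfolding t2 F_f a_def of_real_sum complex_norm_square
          by (simp add: sum_divide_distrib mult.commute)
        then show ?thesis using \<open>t > 0\<close> by (simp add: power2_eq_square)
      qed
      ultimately show ?thesis using \<open>t > 0\<close> by (simp flip: t2 add: power_mono)
    qed
  qed
  \<comment> \<open>The diagonal entry at \<open>\<pi> j\<close> of the projection onto the span of
    the \<open>u l\<close>: at most 1 by Bessel, with total \<open>m\<close>.\<close>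
  define q where "q = (\<lambda>j. \<Sum>l<m. (cmod (u l (\<pi> j)))\<^sup>2)"
  have "torus_int (\<lambda>x. \<Sum>l<m. of_real ((cmod (f l x))\<^sup>2)) =
      (\<Sum>l<m. torus_int (\<lambda>x. of_real ((cmod (f l x))\<^sup>2)))"
    and int: "set_integrable lebesgue torus_cube (\<lambda>x. \<Sum>l<m. complex_of_real ((cmod (f l x))\<^sup>2))"
  proof -
    have tp: "trig_poly (\<lambda>x. complex_of_real ((cmod (f l x))\<^sup>2))" for l
    proof -
      have "trig_poly (f l)" unfolding f_def by (rule trig_poly_char_sum)
      then show ?thesis unfolding complex_norm_square by (intro trig_poly_mult trig_poly_cnj)
    qed
    then show "torus_int (\<lambda>x. \<Sum>l<m. of_real ((cmod (f l x))\<^sup>2)) =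
      (\<Sum>l<m. torus_int (\<lambda>x. of_real ((cmod (f l x))\<^sup>2)))"
      by (intro torus_int_sum trig_poly_set_integrable)
    show "set_integrable lebesgue torus_cube (\<lambda>x. \<Sum>l<m. complex_of_real ((cmod (f l x))\<^sup>2))"
      by (intro trig_poly_set_integrable trig_poly_sum tp)
  qed
  note this(1)
  also have "(\<Sum>l<m. torus_int (\<lambda>x. of_real ((cmod (f l x))\<^sup>2)))
      = of_real (\<Sum>l<m. \<Sum>k\<in>K. (cmod (u l k / of_real (w k)))\<^sup>2)"
    unfolding f_def of_real_sum[of _ "{..<m}"] by (intro sum.cong refl char_sum_parseval K(1))
  also have "(\<Sum>l<m. \<Sum>k\<in>K. (cmod (u l k / of_real (w k)))\<^sup>2)
      = (\<Sum>k\<in>K. (1 / w k)\<^sup>2 * (\<Sum>l<m. (cmod (u l k))\<^sup>2))"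
    using w_pos by (subst sum.swap) (simp add: norm_divide power_divide sum_divide_distrib)
  also have "\<dots> = (\<Sum>j=1..N. (\<sigma> j)\<^sup>2 * q j)"
    unfolding sum_K by (intro sum.cong refl) (simp add: \<sigma>_def q_def)
  finally have "(\<Sum>j=1..N. (\<sigma> j)\<^sup>2 * q j) \<le> cmod (torus_int (\<lambda>x. \<Sum>l<m. of_real ((cmod (f l x))\<^sup>2)))"
    by (simp only: norm_of_real abs_ge_self)
  also have "\<dots> \<le> e\<^sup>2"
  proof (rule norm_torus_int_le[OF int])
    have "cmod (\<Sum>l<m. complex_of_real ((cmod (f l x))\<^sup>2)) = (\<Sum>l<m. (cmod (f l x))\<^sup>2)" for x
      unfolding of_real_sum[symmetric] norm_of_real by (simp add: sum_nonneg)
    with AE_torus_cube_interior square_le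
    show "AE x in lebesgue. x \<in> torus_cube \<longrightarrow> cmod (\<Sum>l<m. complex_of_real ((cmod (f l x))\<^sup>2)) \<le> e\<^sup>2"
      by (auto elim!: eventually_mono)
  qed
  finally have "(\<Sum>j=1..N. (\<sigma> j)\<^sup>2 * q j) \<le> e\<^sup>2" .
  moreover have "(\<Sum>j=n..N. (\<sigma> j)\<^sup>2) \<le> (\<Sum>j=1..N. (\<sigma> j)\<^sup>2 * q j)"
  proof (rule antimono_weighted_sum_ge_tail[OF n])
    fix i j :: nat assume "1 \<le> i" "i \<le> j"
    then show "(\<sigma> j)\<^sup>2 \<le> (\<sigma> i)\<^sup>2"
      using \<sigma>_mono w_pos[of "\<pi> j"] by (intro power_mono) (auto simp: \<sigma>_def less_imp_le)
  next
    fix j assume "j \<in> {1..N}"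
    then show "0 \<le> q j \<and> q j \<le> 1"
      using orthonormal_on_coordinate_le_1[OF u K(1)] by (auto simp: q_def K_def sum_nonneg)
  next
    have "(\<Sum>j=1..N. q j) = (\<Sum>l<m. \<Sum>k\<in>K. (cmod (u l k))\<^sup>2)"
      unfolding q_def sum_K by (rule sum.swap)
    also have "\<dots> = real m" by (simp add: orthonormal_on_norm[OF u])
    finally show "(\<Sum>j=1..N. q j) = real (Suc N - n)" by (simp add: m_def)
  qed
  ultimately show ?thesis by linarith
qed

section \<open>The approximation numbers\<close>

text \<open>\<open>rank_less\<close> indexes coefficients by functions rather than frequencies, so a
  frequency must be recoverable from its character.\<close>

lemma inj_fourier_char: "inj fourier_char"
proof (rule injI, rule ccontr)
  fix k j :: "int^'n" assume eq: "fourier_char k = fourier_char j" and "k \<noteq> j"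
  have "fourier_coeff (char_sum {k} (\<lambda>_. 1)) k = fourier_coeff (char_sum {j} (\<lambda>_. 1)) k"
    by (simp add: eq)
  then show False using \<open>k \<noteq> j\<close> by (simp only: fourier_coeff_char_sum finite.intros) simp
qed

lemma Wiener_norm_char_sum:
  assumes "finite K"
  shows "Wiener_norm (char_sum K c) = (\<Sum>k\<in>K. cmod (c k))"
proof -
  have "Wiener_norm (char_sum K c) = infsum (\<lambda>k. cmod (c k)) K"
    unfolding Wiener_norm_def
    using assms by (intro infsum_cong_neutral) (auto simp: fourier_coeff_char_sum)
  then show ?thesis using assms by simp
qed

text \<open>The target enters through the sandwich \<open>lower\<close> and \<open>upper\<close>,
  the triangle inequality, and the fact that it contains the character sums. The truncation
  \<open>A0\<close> attains the infimum, which is thus a minimum.\<close>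

lemma approx_num_eq_tail:
  fixes w :: "int^'n \<Rightarrow> real" and \<sigma> :: "nat \<Rightarrow> real" and \<pi> :: "nat \<Rightarrow> int^'n"
    and Y :: "(real^'n \<Rightarrow> complex) set"
  assumes w_pos: "\<And>k. w k > 0"
    and w_sum: "(\<lambda>k. 1 / (w k)\<^sup>2) summable_on UNIV"
    and \<pi>_bij: "bij_betw \<pi> {1..} UNIV"
    and \<sigma>_def: "\<And>j. j \<ge> 1 \<Longrightarrow> \<sigma> j = 1 / w (\<pi> j)"
    and \<sigma>_mono: "\<And>i j. 1 \<le> i \<Longrightarrow> i \<le> j \<Longrightarrow> \<sigma> j \<le> \<sigma> i"
    and n: "n \<ge> 1"
    and char_sum_Y: "\<And>K c. finite K \<Longrightarrow> char_sum K c \<in> Y"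
    and triangle: "\<And>f g. f \<in> F_space w \<Longrightarrow> g \<in> Y \<Longrightarrow> NY (\<lambda>x. f x - g x) \<le> NY f + NY g"
    and upper: "\<And>f. f \<in> F_space w \<Longrightarrow> NY f \<le> Wiener_norm f"
    and lower: "\<And>f. f \<in> F_space w \<Longrightarrow> Linf_norm f \<le> NY f"
  shows "approx_num (F_space w) (F_norm w) Y NY n = sqrt (\<Sum>\<^sub>\<infinity>j\<in>{n..}. (\<sigma> j)\<^sup>2)"
proof -
  define R where "R = sqrt (\<Sum>\<^sub>\<infinity>j\<in>{n..}. (\<sigma> j)\<^sup>2)"
  define W where "W = sqrt (\<Sum>\<^sub>\<infinity>k. 1 / (w k)\<^sup>2)"
  define ball where "ball = {f \<in> F_space w. F_norm w f \<le> 1}"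
  define adm where "adm = (\<lambda>A. (\<forall>f\<in>F_space w. A f \<in> Y) \<and> lin_on (F_space w) A \<and>
    bounded_op (F_space w) (F_norm w) NY A \<and> rank_less (F_space w) A n)"
  define err where "err = (\<lambda>A. SUP f\<in>ball. NY (\<lambda>x. f x - A f x))"
  have \<pi>_inj: "inj_on \<pi> {1..}" using \<pi>_bij by (simp add: bij_betw_def)
  have tail_inj: "inj_on \<pi> {n..}" using n by (intro inj_on_subset[OF \<pi>_inj]) auto
  have zero: "(\<lambda>x. 0) \<in> ball"
    using char_sum_F_space[of "{}" "\<lambda>_. 0" w] F_norm_char_sum[of "{}" w "\<lambda>_. 0"]
    by (simp add: ball_def)
  have tail: "(\<lambda>j. (\<sigma> j)\<^sup>2) summable_on {n..}"
    "(\<Sum>\<^sub>\<infinity>j\<in>{n..}. (\<sigma> j)\<^sup>2) = (\<Sum>\<^sub>\<infinity>k\<in>\<pi> ` {n..}. 1 / (w k)\<^sup>2)"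
  proof -
    have \<sigma>2: "(\<sigma> j)\<^sup>2 = ((\<lambda>k. 1 / (w k)\<^sup>2) \<circ> \<pi>) j" if "j \<in> {n..}" for j
      using that n by (simp add: \<sigma>_def power_one_over)
    have "(\<lambda>k. 1 / (w k)\<^sup>2) summable_on \<pi> ` {n..}"
      using w_sum by (rule summable_on_subset) auto
    then have "((\<lambda>k. 1 / (w k)\<^sup>2) \<circ> \<pi>) summable_on {n..}"
      using summable_on_reindex[OF tail_inj] by blast
    then show "(\<lambda>j. (\<sigma> j)\<^sup>2) summable_on {n..}"
      by (subst summable_on_cong[OF \<sigma>2]) auto
    show "(\<Sum>\<^sub>\<infinity>j\<in>{n..}. (\<sigma> j)\<^sup>2) = (\<Sum>\<^sub>\<infinity>k\<in>\<pi> ` {n..}. 1 / (w k)\<^sup>2)"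
      by (subst infsum_reindex[OF tail_inj]) (intro infsum_cong \<sigma>2)
  qed
  have NY_le: "NY f \<le> W * F_norm w f" if "f \<in> F_space w" for f
    using upper[OF that] F_space_coeff_sum_le[OF that w_pos w_sum]
    by (simp add: W_def Wiener_norm_def)
  have lower_bound: "R \<le> err A" if A: "adm A" for A
  proof -
    obtain C where C: "\<And>f. f \<in> F_space w \<Longrightarrow> NY (A f) \<le> C * F_norm w f"
      using A by (auto simp: adm_def bounded_op_def)
    \<comment> \<open>A real supremum dominates its members only over a bounded set; here the
      boundedness of \<open>A\<close> is used.\<close>
    have bdd: "bdd_above ((\<lambda>f. NY (\<lambda>x. f x - A f x)) ` ball)"
    proof (rule bdd_aboveI2)
      fix f assume f: "f \<in> ball"
      then have fF: "f \<in> F_space w" "F_norm w f \<le> 1" by (auto simp: ball_def)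
      have "NY (\<lambda>x. f x - A f x) \<le> NY f + NY (A f)"
        using A fF by (intro triangle) (auto simp: adm_def)
      also have "\<dots> \<le> (W + C) * F_norm w f"
        using NY_le[OF fF(1)] C[OF fF(1)] by (simp add: algebra_simps)
      also have "\<dots> \<le> \<bar>W + C\<bar> * F_norm w f"
        by (intro mult_right_mono F_norm_nonneg) auto
      also have "\<dots> \<le> \<bar>W + C\<bar>" using fF(2) by (intro mult_left_le) auto
      finally show "NY (\<lambda>x. f x - A f x) \<le> \<bar>W + C\<bar>" .
    qed
    have bound: "Linf_norm f \<le> err A"
      if "f \<in> F_space w" "F_norm w f \<le> 1" "A f = (\<lambda>x. 0)" for f
    proof -
      have "Linf_norm f \<le> NY (\<lambda>x. f x - A f x)" using lower[OF that(1)] that(3) by simp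
      also have "\<dots> \<le> err A"
        unfolding err_def using that by (intro cSUP_upper bdd) (simp add: ball_def)
      finally show ?thesis .
    qed
    have zero_op: "A (\<lambda>x. 0) = (\<lambda>x. 0)"
      using lin_on_char_sum[of w A "{}" "\<lambda>_. 0"] A by (simp add: adm_def)
    \<comment> \<open>Nonnegativity of the error, required for passing from squares to square roots
      at the end.\<close>
    have "0 \<le> Linf_norm (\<lambda>x::real^'n. 0)"
      by (intro Linf_norm_nonneg trig_poly_Linf trig_poly_const)
    also have "\<dots> \<le> err A"
      using zero by (intro bound zero_op) (auto simp: ball_def)
    finally have "0 \<le> err A" .
    have partial: "(\<Sum>j=n..N. (\<sigma> j)\<^sup>2) \<le> (err A)\<^sup>2" for N
    proof (cases "n \<le> N")
      case True
      have "lin_on (F_space w) A" "rank_less (F_space w) A n" using A by (auto simp: adm_def)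
      from annihilated_tail_bound[OF w_pos \<pi>_inj \<sigma>_def \<sigma>_mono n True this bound]
      show ?thesis .
    qed simp
    have "(\<Sum>\<^sub>\<infinity>j\<in>{n..}. (\<sigma> j)\<^sup>2) \<le> (err A)\<^sup>2"
    proof (rule infsum_le_finite_sums[OF tail(1)])
      fix J assume J: "finite J" "J \<subseteq> {n..}"
      \<comment> \<open>Inserting \<open>n\<close> keeps \<open>Max\<close> meaningful when
        \<open>J\<close> is empty.\<close>
      then have "J \<subseteq> {n..Max (insert n J)}" by auto
      then have "(\<Sum>j\<in>J. (\<sigma> j)\<^sup>2) \<le> (\<Sum>j=n..Max (insert n J). (\<sigma> j)\<^sup>2)"
        by (intro sum_mono2) auto
      with partial show "(\<Sum>j\<in>J. (\<sigma> j)\<^sup>2) \<le> (err A)\<^sup>2" using order_trans by blast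
    qed
    then show ?thesis unfolding R_def using \<open>0 \<le> err A\<close> by (intro real_le_lsqrt)
  qed
  \<comment> \<open>The range stops before \<open>n\<close>: it has n - 1 indices, as the strict
    rank condition demands, and is empty for n = 1, where \<open>A0\<close> is the zero
    operator.\<close>
  define K where "K = \<pi> ` {1..<n}"
  have K: "finite K" "card K \<le> n - 1"
    using card_image_le[of "{1..<n}" \<pi>] by (auto simp: K_def)
  have compl: "- K = \<pi> ` {n..}"
  proof -
    have "{1..} = {1..<n} \<union> {n..}" using n by auto
    then have "UNIV = K \<union> \<pi> ` {n..}" using \<pi>_bij by (simp add: K_def bij_betw_def image_Un[symmetric])
    moreover have "K \<inter> \<pi> ` {n..} = {}"
      unfolding K_def using n by (subst inj_on_image_Int[OF \<pi>_inj, symmetric]) auto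
    ultimately show ?thesis by blast
  qed
  define A0 where "A0 = (\<lambda>f. char_sum K (fourier_coeff f))"
  have A0_F: "A0 f \<in> F_space w" for f unfolding A0_def using K(1) by (rule char_sum_F_space)
  have "adm A0"
    unfolding adm_def
  proof (intro conjI ballI)
    show "A0 f \<in> Y" for f unfolding A0_def using K(1) by (rule char_sum_Y)
    show "lin_on (F_space w) A0"
      unfolding lin_on_def
    proof (intro ballI allI)
      fix f g a b assume "f \<in> F_space w" "g \<in> F_space w"
      then have "fourier_coeff (\<lambda>x. a * f x + b * g x) k = a * fourier_coeff f k + b * fourier_coeff g k" for k
        by (intro fourier_coeff_lincomb) (auto simp: F_space_def L1_torus_def)
      then show "A0 (\<lambda>x. a * f x + b * g x) = (\<lambda>x. a * A0 f x + b * A0 g x)"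
        by (simp add: A0_def sum_distrib_left sum.distrib algebra_simps)
    qed
    show "bounded_op (F_space w) (F_norm w) NY A0"
      unfolding bounded_op_def
    proof (intro exI ballI)
      fix f assume f: "f \<in> F_space w"
      have "NY (A0 f) \<le> Wiener_norm (A0 f)" by (intro upper A0_F)
      also have "\<dots> = (\<Sum>k\<in>K. cmod (fourier_coeff f k))"
        unfolding A0_def by (rule Wiener_norm_char_sum[OF K(1)])
      also have "\<dots> = infsum (\<lambda>k. cmod (fourier_coeff f k)) K" using K(1) by simp
      also have "\<dots> \<le> sqrt (\<Sum>\<^sub>\<infinity>k\<in>K. 1 / (w k)\<^sup>2) * F_norm w f"
        by (intro F_space_coeff_sum_le[OF f w_pos] summable_on_finite K(1))
      finally show "NY (A0 f) \<le> sqrt (\<Sum>\<^sub>\<infinity>k\<in>K. 1 / (w k)\<^sup>2) * F_norm w f" .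
    qed
    show "rank_less (F_space w) A0 n"
      unfolding rank_less_def
    proof (intro exI[of _ "fourier_char ` K"] conjI ballI)
      show "finite (fourier_char ` K)" using K(1) by simp
      show "card (fourier_char ` K) < n" using card_image_le[OF K(1), of fourier_char] K(2) n by linarith
      fix f
      have inj: "inj_on fourier_char K" using inj_fourier_char by (rule inj_on_subset) auto
      show "\<exists>c. A0 f = (\<lambda>x. \<Sum>g\<in>fourier_char ` K. c g * g x)"
        by (intro exI[of _ "\<lambda>g. fourier_coeff f (inv fourier_char g)"])
           (simp add: A0_def sum.reindex[OF inj] inv_f_f[OF inj_fourier_char])
    qed
  qed
  have "err A0 \<le> R"
    unfolding err_def
  proof (rule cSUP_least)
    show "ball \<noteq> {}" using zero by blast
    fix f assume "f \<in> ball"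
    then have f: "f \<in> F_space w" "F_norm w f \<le> 1" by (auto simp: ball_def)
    have f1: "f \<in> L1_torus" "A0 f \<in> L1_torus" using f(1) A0_F by (auto simp: F_space_def)
    have coeff: "fourier_coeff (\<lambda>x. f x - A0 f x) k = (if k \<in> K then 0 else fourier_coeff f k)" for k
    proof -
      have "fourier_coeff (\<lambda>x. f x - A0 f x) k = fourier_coeff f k - fourier_coeff (A0 f) k"
        using f1 by (intro fourier_coeff_diff) (auto simp: L1_torus_def)
      then show ?thesis by (simp add: A0_def fourier_coeff_char_sum[OF K(1)])
    qed
    have "(\<lambda>k. (w k)\<^sup>2 * (cmod (fourier_coeff f k))\<^sup>2) summable_on UNIV"
      using f(1) by (simp add: F_space_def)
    then have "(\<lambda>k. (w k)\<^sup>2 * (cmod (fourier_coeff (\<lambda>x. f x - A0 f x) k))\<^sup>2) summable_on UNIV"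
      by (rule summable_on_comparison_test) (auto simp: coeff)
    then have "(\<lambda>x. f x - A0 f x) \<in> F_space w"
      using L1_torus_diff[OF f1] by (simp add: F_space_def)
    then have "NY (\<lambda>x. f x - A0 f x) \<le> Wiener_norm (\<lambda>x. f x - A0 f x)" by (rule upper)
    also have "\<dots> = (\<Sum>\<^sub>\<infinity>k\<in>- K. cmod (fourier_coeff f k))"
      unfolding Wiener_norm_def by (intro infsum_cong_neutral) (auto simp: coeff)
    also have "\<dots> \<le> sqrt (\<Sum>\<^sub>\<infinity>k\<in>- K. 1 / (w k)\<^sup>2) * F_norm w f"
      by (intro F_space_coeff_sum_le[OF f(1) w_pos] summable_on_subset[OF w_sum]) auto
    also have "\<dots> = R * F_norm w f" by (simp add: R_def tail(2) compl)
    also have "\<dots> \<le> R" using f(2) by (intro mult_left_le) (auto simp: R_def infsum_nonneg)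
    finally show "NY (\<lambda>x. f x - A0 f x) \<le> R" .
  qed
  with lower_bound \<open>adm A0\<close> have "err A0 = R" by (intro antisym) auto
  have "approx_num (F_space w) (F_norm w) Y NY n = Inf {err A | A. adm A}"
    unfolding approx_num_def err_def adm_def ball_def ..
  also have "\<dots> = R"
    using \<open>adm A0\<close> \<open>err A0 = R\<close> lower_bound by (intro cInf_eq_minimum) auto
  finally show ?thesis by (simp add: R_def)
qed

theorem theorem2:
  fixes w :: "int^'n \<Rightarrow> real" and \<sigma> :: "nat \<Rightarrow> real" and \<pi> :: "nat \<Rightarrow> int^'n" and n :: nat
  assumes w_pos: "\<And>k. w k > 0"
    and w_sum: "(\<lambda>k. 1 / (w k)\<^sup>2) summable_on UNIV"
    and \<pi>_bij: "bij_betw \<pi> {1..} UNIV"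
    and \<sigma>_def: "\<And>j. j \<ge> 1 \<Longrightarrow> \<sigma> j = 1 / w (\<pi> j)"
    and \<sigma>_mono: "\<And>i j. 1 \<le> i \<Longrightarrow> i \<le> j \<Longrightarrow> \<sigma> j \<le> \<sigma> i"
    and n: "n \<ge> 1"
  shows "approx_num (F_space w) (F_norm w) Wiener_space Wiener_norm n
           = sqrt (\<Sum>\<^sub>\<infinity>j\<in>{n..}. (\<sigma> j)\<^sup>2)
       \<and> approx_num (F_space w) (F_norm w) C_space Linf_norm n
           = sqrt (\<Sum>\<^sub>\<infinity>j\<in>{n..}. (\<sigma> j)\<^sup>2)
       \<and> approx_num (F_space w) (F_norm w) Linf_space Linf_norm n
           = sqrt (\<Sum>\<^sub>\<infinity>j\<in>{n..}. (\<sigma> j)\<^sup>2)"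
proof -
  have F_W: "f \<in> Wiener_space" if "f \<in> F_space w" for f
    using F_space_coeff_summable[OF that w_pos w_sum] that by (simp add: Wiener_space_def F_space_def)
  then have F_Linf: "f \<in> Linf_space" if "f \<in> F_space w" for f
    using that Wiener_space_subset_Linf_space by blast
  have C_Linf: "g \<in> Linf_space" if "g \<in> C_space" for g :: "real^'n \<Rightarrow> complex"
    using that by (simp add: C_space_def)
  \<comment> \<open>The instances differ in one end of the sandwich: for \<open>Wiener_norm\<close>
    the upper inequality is trivial, for \<open>Linf_norm\<close> the lower one.\<close>
  note main = approx_num_eq_tail[OF w_pos w_sum \<pi>_bij \<sigma>_def \<sigma>_mono n]
  show ?thesis
    by (intro conjI main)
       (auto intro: char_sum_Wiener trig_poly_C_space trig_poly_Linf trig_poly_char_sum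
          Wiener_norm_diff_le Linf_norm_diff_le Linf_norm_le_Wiener_norm F_W F_Linf C_Linf)
qed

end
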